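(* Let $M=gK_I$ be a non-trivial nearly invariant subspace of $H^2$ with extremal function $g$ and corresponding inner function $I$, $I(0)=0$, and let $\zeta\in\mathbb{T}$. Then every function in $M$ has a finite non-tangential limit at $\zeta$ if and only if the following two conditions are satisfied: (1) $g$ has a finite non-tangential limit at $\zeta$; (2) for every Stolz region $\Gamma_\alpha(\zeta)$ ($\alpha>1$) at $\zeta$, the family $F^M_{\alpha,\zeta}:=\{k^M_\lambda:\lambda\in\Gamma_\alpha(\zeta)\}$ is uniformly norm bounded, i.e. $$\sup\left\{\|k^M_\lambda\|^2=|g(\lambda)|^2\,\frac{1-|I(\lambda)|^2}{1-|\lambda|^2}:\ \lambda\in\Gamma_\alpha(\zeta)\right\}<\infty.$$
   Context: $\mathbb{D}$ is the open unit disk, $\mathbb{T}=\partial\mathbb{D}$, and $H^2$ is the Hardy space of $\mathbb{D}$ with its usual norm $\|\cdot\|$. For an inner function $I$, $K_I:=H^2\ominus IH^2$ is the model space. For $\zeta\in\mathbb{T}$ and $\alpha>1$, $\Gamma_\alpha(\zeta):=\{z\in\mathbb{D}:\frac{|z-\zeta|}{1-|z|}<\alpha\}$ is the Stolz domain with vertex $\zeta$. A function on $\mathbb{D}$ has non-tangential limit $L$ at $\zeta$ if, for every $\alpha>1$, it tends to $L$ as $\lambda\to\zeta$ within $\Gamma_\alpha(\zeta)$. A closed subspace $M\subset H^2$ is nearly invariant if $f\in M$, $f(0)=0$ imply $f/z\in M$; non-trivial means $M\neq\{0\}$. The extremal function $g$ of such an $M$ is the unique solution of the extremal problem $\sup\{\operatorname{Re}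 g(0): g\in M,\ \|g\|=1\}$. "Nearly invariant subspace $M=gK_I$ with extremal function $g$ and corresponding inner function $I$" means that $M$ is nearly invariant, $g$ is its extremal function, $I$ is inner with $I(0)=0$, $M=gK_I=\{gh:h\in K_I\}$, and multiplication by $g$ is an isometry of $K_I$ onto $M$; by theorems of Hitt and Sarason, such a $g$ has the form $g=a/(1-Ib)$ with $a,b$ in the unit ball of $H^\infty$ and $|a|^2+|b|^2=1$ a.e. on $\mathbb{T}$. For $\lambda\in\mathbb{D}$, $k^M_\lambda$ denotes the reproducing kernel of $M$ at $\lambda$: $k^M_\lambda(z)=\overline{g(\lambda)}g(z)\frac{1-\overline{I(\lambda)}I(z)}{1-\overline{\lambda}z}$. *)

theory Defs
  imports "HOL-Complex_Analysis.Complex_Analysis"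
begin

abbreviation unit_disc :: "complex set" where
  "unit_disc \<equiv> ball 0 1"

definition taylor_coeff :: "(complex \<Rightarrow> complex) \<Rightarrow> nat \<Rightarrow> complex" where
  "taylor_coeff f n = (deriv ^^ n) f 0 / fact n"

text \<open>
  Functions on the disc are represented by total functions that vanish off the disc, so that
  equality of elements of the Hardy space is equality in HOL.
\<close>

definition hardy2 :: "(complex \<Rightarrow> complex) set" where
  "hardy2 = {f. f holomorphic_on unit_disc \<and> (\<forall>z. z \<notin> unit_disc \<longrightarrow> f z = 0) \<and>
                summable (\<lambda>n. (cmod (taylor_coeff f n))\<^sup>2)}"

definition h2_inner :: "(complex \<Rightarrow> complex) \<Rightarrow> (complex \<Rightarrow> complex) \<Rightarrow> complex" where
  "h2_inner f h = (\<Sum>n. taylor_coeff f n * cnj (taylor_coeff h n))"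

definition h2_norm :: "(complex \<Rightarrow> complex) \<Rightarrow> real" where
  "h2_norm f = sqrt (\<Sum>n. (cmod (taylor_coeff f n))\<^sup>2)"

text \<open>
  Only the values of an inner function on the disc matter. Its radial limits are parametrised by
  the angle \<open>t\<close> over the whole real line; by periodicity this is the same as almost everywhere on
  the circle with respect to arc length.
\<close>

definition inner_function :: "(complex \<Rightarrow> complex) \<Rightarrow> bool" where
  "inner_function I \<longleftrightarrow>
     I holomorphic_on unit_disc \<and> (\<forall>z\<in>unit_disc. cmod (I z) \<le> 1) \<and>
     (AE t in lborel. \<exists>w. cmod w = 1 \<and>
        ((\<lambda>r. I (complex_of_real r * cis t)) \<longlongrightarrow> w) (at_left 1))"

definition model_space :: "(complex \<Rightarrow> complex) \<Rightarrow> (complex \<Rightarrow> complex) set" where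
  "model_space I = {f \<in> hardy2. \<forall>h\<in>hardy2. h2_inner f (\<lambda>z. I z * h z) = 0}"

definition closed_subspace_h2 :: "(complex \<Rightarrow> complex) set \<Rightarrow> bool" where
  "closed_subspace_h2 M \<longleftrightarrow>
     M \<subseteq> hardy2 \<and> (\<lambda>_. 0) \<in> M \<and>
     (\<forall>f\<in>M. \<forall>h\<in>M. (\<lambda>z. f z + h z) \<in> M) \<and>
     (\<forall>c. \<forall>f\<in>M. (\<lambda>z. c * f z) \<in> M) \<and>
     (\<forall>F. \<forall>f\<in>hardy2. (\<forall>n::nat. F n \<in> M) \<longrightarrow>
        (\<lambda>n. h2_norm (\<lambda>z. F n z - f z)) \<longlonglongrightarrow> 0 \<longrightarrow> f \<in> M)"

text \<open>The quotient \<open>f / z\<close> takes the value \<open>f' 0\<close> at its removable singularity.\<close>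

definition nearly_invariant :: "(complex \<Rightarrow> complex) set \<Rightarrow> bool" where
  "nearly_invariant M \<longleftrightarrow>
     closed_subspace_h2 M \<and>
     (\<forall>f\<in>M. f 0 = 0 \<longrightarrow> (\<lambda>z. if z = 0 then deriv f 0 else f z / z) \<in> M)"

definition extremal_function :: "(complex \<Rightarrow> complex) set \<Rightarrow> (complex \<Rightarrow> complex) \<Rightarrow> bool" where
  "extremal_function M g \<longleftrightarrow>
     is_arg_max (\<lambda>h. Re (h 0)) (\<lambda>h. h \<in> M \<and> h2_norm h = 1) g"

definition reproducing_kernel ::
    "(complex \<Rightarrow> complex) set \<Rightarrow> complex \<Rightarrow> complex \<Rightarrow> complex" where
  "reproducing_kernel M w = (THE k. k \<in> M \<and> (\<forall>f\<in>M. h2_inner f k = f w))"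

definition stolz :: "real \<Rightarrow> complex \<Rightarrow> complex set" where
  "stolz \<alpha> \<zeta> = {z \<in> unit_disc. cmod (z - \<zeta>) / (1 - cmod z) < \<alpha>}"

definition has_nt_limit :: "(complex \<Rightarrow> complex) \<Rightarrow> complex \<Rightarrow> complex \<Rightarrow> bool" where
  "has_nt_limit f \<zeta> L \<longleftrightarrow> (\<forall>\<alpha>>1. (f \<longlongrightarrow> L) (at \<zeta> within stolz \<alpha> \<zeta>))"

end

theory Submission
  imports Defs
begin

text \<open>
  Write \<open>k w\<close> for the reproducing kernel of \<open>M\<close> at \<open>w\<close>. Since \<open>g\<close> multiplies \<open>model_space I\<close>
  isometrically onto \<open>M\<close>, and since multiplication by \<open>I\<close> is an isometry of the Hardy space, the
  kernel of the model space is \<open>(1 - cnj (I w) * I z) / (1 - cnj w * z)\<close> and \<open>k w\<close> arises from it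
  by the factor \<open>cnj (g w) * g z\<close>. Evaluating \<open>k w\<close> at \<open>w\<close> gives the formula for its norm.

  If every function in \<open>M\<close> has a non-tangential limit at \<open>\<zeta>\<close>, so does \<open>g\<close>, which belongs to \<open>M\<close>.
  Moreover every function in \<open>M\<close> is then bounded on every Stolz domain (near \<open>\<zeta>\<close> by the limit, away
  from \<open>\<zeta>\<close> because that part of the domain is relatively compact in the disc). In other words the
  kernels are pointwise bounded functionals on the complete space \<open>M\<close>, and they are bounded in norm
  by the uniform boundedness principle (\<open>uniform_boundedness_h2\<close>).

  Conversely, let \<open>g\<close> have a limit \<open>L\<close> and let the kernels be bounded by \<open>C\<close> on a Stolz domain.
  Then \<open>G = g * I\<close> has a limit as well (\<open>tendsto_gI\<close>): the Cauchy-Schwarz bound on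
  \<open>k x y = h2_inner (k x) (k y)\<close> says that \<open>cnj (g x) * g y - cnj (G x) * G y\<close> is at most
  \<open>C\<^sup>2 * cmod (1 - cnj x * y)\<close>, which tends to zero as \<open>x\<close> and \<open>y\<close> tend to \<open>\<zeta>\<close>. Hence
  \<open>cnj (G x) * G y\<close> tends to \<open>cnj L * L\<close>, and expanding \<open>(cmod (G x - G y))\<^sup>2\<close> shows that \<open>G\<close> is
  Cauchy. This takes the place of the theorem of Julia and Caratheodory. Consequently
  \<open>g * (P - I * Q)\<close> has a limit for all polynomials \<open>P\<close> and \<open>Q\<close>. The functions of this form in \<open>M\<close>
  are dense, because the orthogonal projection onto the model space maps a polynomial \<open>P\<close> to
  \<open>P - I * Q\<close> for a polynomial \<open>Q\<close> (\<open>model_space_dense\<close>). Bounded kernels turn approximation in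
  norm into uniform approximation on the Stolz domain, which preserves the existence of limits.
\<close>

section \<open>The Hardy space as a Hilbert space\<close>

lemma taylor_coeff_sums:
  assumes "f holomorphic_on unit_disc" "z \<in> unit_disc"
  shows "(\<lambda>n. taylor_coeff f n * z ^ n) sums f z"
  using holomorphic_power_series[OF assms] by (simp add: taylor_coeff_def)

text \<open>
  Taylor coefficients of sums, multiples and explicit functions are all read off from a power
  series by this uniqueness statement, which avoids computing higher derivatives.
\<close>

lemma power_series_on_disc:
  assumes "\<And>z. z \<in> unit_disc \<Longrightarrow> (\<lambda>n. a n * z ^ n) sums f z"
  shows "f holomorphic_on unit_disc" and "taylor_coeff f = a"
proof -
  show "f holomorphic_on unit_disc"
    by (rule power_series_holomorphic[of 0 1 a]) (use assms in auto)
  have ev: "\<forall>\<^sub>F u in nhds 0. u \<in> unit_disc"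
    by (rule eventually_nhds_in_open) auto
  have "f has_fps_expansion Abs_fps a"
  proof (rule has_fps_expansionI)
    show "\<forall>\<^sub>F u in nhds 0. (\<lambda>n. fps_nth (Abs_fps a) n * u ^ n) sums f u"
      using ev by eventually_elim (use assms in auto)
  qed
  from fps_nth_fps_expansion[OF this] show "taylor_coeff f = a"
    by (auto simp: taylor_coeff_def fun_eq_iff)
qed

lemma hardy2I:
  assumes "\<And>z. z \<in> unit_disc \<Longrightarrow> (\<lambda>n. a n * z ^ n) sums f z"
    and "\<And>z. z \<notin> unit_disc \<Longrightarrow> f z = 0"
    and "summable (\<lambda>n. (cmod (a n))\<^sup>2)"
  shows "f \<in> hardy2"
  unfolding hardy2_def using power_series_on_disc[of a f] assms by auto

lemma hardy2D:
  assumes "f \<in> hardy2"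
  shows "f holomorphic_on unit_disc" "z \<notin> unit_disc \<Longrightarrow> f z = 0"
    "summable (\<lambda>n. (cmod (taylor_coeff f n))\<^sup>2)"
    "z \<in> unit_disc \<Longrightarrow> (\<lambda>n. taylor_coeff f n * z ^ n) sums f z"
  using assms taylor_coeff_sums[of f z] unfolding hardy2_def by auto

lemma taylor_coeff_add:
  assumes "f \<in> hardy2" "h \<in> hardy2"
  shows "taylor_coeff (\<lambda>z. f z + h z) = (\<lambda>n. taylor_coeff f n + taylor_coeff h n)"
  by (rule power_series_on_disc) (auto simp: algebra_simps intro!: sums_add hardy2D assms)

lemma taylor_coeff_cmult:
  assumes "f \<in> hardy2"
  shows "taylor_coeff (\<lambda>z. c * f z) = (\<lambda>n. c * taylor_coeff f n)"
  by (rule power_series_on_disc) (auto simp: mult.assoc intro!: sums_mult hardy2D assms)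

lemma summable_add_sq:
  fixes a b :: "nat \<Rightarrow> complex"
  assumes "summable (\<lambda>n. (cmod (a n))\<^sup>2)" "summable (\<lambda>n. (cmod (b n))\<^sup>2)"
  shows "summable (\<lambda>n. (cmod (a n + b n))\<^sup>2)"
proof (rule summable_comparison_test')
  show "summable (\<lambda>n. 2 * (cmod (a n))\<^sup>2 + 2 * (cmod (b n))\<^sup>2)"
    by (intro summable_add summable_mult assms)
  show "norm ((cmod (a n + b n))\<^sup>2) \<le> 2 * (cmod (a n))\<^sup>2 + 2 * (cmod (b n))\<^sup>2" if "n \<ge> 0" for n
  proof -
    have "(cmod (a n + b n))\<^sup>2 \<le> (cmod (a n) + cmod (b n))\<^sup>2"
      by (intro power_mono norm_triangle_ineq) auto
    also have "\<dots> \<le> 2 * (cmod (a n))\<^sup>2 + 2 * (cmod (b n))\<^sup>2"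
      using sum_squares_bound[of "cmod (a n)" "cmod (b n)"] by (simp add: power2_sum)
    finally show ?thesis by simp
  qed
qed

lemma hardy2_add:
  assumes "f \<in> hardy2" "h \<in> hardy2"
  shows "(\<lambda>z. f z + h z) \<in> hardy2"
proof (rule hardy2I[of "\<lambda>n. taylor_coeff f n + taylor_coeff h n"])
qed (use assms in \<open>auto simp: algebra_simps hardy2D intro!: sums_add hardy2D(4) summable_add_sq hardy2D(3)\<close>)

lemma hardy2_cmult:
  assumes "f \<in> hardy2"
  shows "(\<lambda>z. c * f z) \<in> hardy2"
proof (rule hardy2I[of "\<lambda>n. c * taylor_coeff f n"])
qed (use assms in \<open>auto simp: mult.assoc hardy2D norm_mult power_mult_distrib
      intro!: sums_mult hardy2D(4) summable_mult hardy2D(3)\<close>)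

lemma hardy2_diff:
  assumes "f \<in> hardy2" "h \<in> hardy2"
  shows "(\<lambda>z. f z - h z) \<in> hardy2"
  using hardy2_add[OF assms(1) hardy2_cmult[OF assms(2), of "-1"]] by simp

lemma taylor_coeff_diff:
  assumes "f \<in> hardy2" "h \<in> hardy2"
  shows "taylor_coeff (\<lambda>z. f z - h z) = (\<lambda>n. taylor_coeff f n - taylor_coeff h n)"
  by (rule power_series_on_disc) (auto simp: algebra_simps intro!: sums_diff hardy2D assms)

lemma h2_inner_sums:
  assumes "f \<in> hardy2" "h \<in> hardy2"
  shows "(\<lambda>n. taylor_coeff f n * cnj (taylor_coeff h n)) sums h2_inner f h"
proof -
  have "summable (\<lambda>n. taylor_coeff f n * cnj (taylor_coeff h n))"
  proof (rule summable_comparison_test')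
    show "summable (\<lambda>n. (cmod (taylor_coeff f n))\<^sup>2 + (cmod (taylor_coeff h n))\<^sup>2)"
      by (intro summable_add hardy2D assms)
    show "norm (taylor_coeff f n * cnj (taylor_coeff h n)) \<le>
        (cmod (taylor_coeff f n))\<^sup>2 + (cmod (taylor_coeff h n))\<^sup>2" for n
      using sum_squares_bound[of "cmod (taylor_coeff f n)" "cmod (taylor_coeff h n)"]
        mult_nonneg_nonneg[OF norm_ge_zero norm_ge_zero, of "taylor_coeff f n" "taylor_coeff h n"]
      unfolding norm_mult complex_mod_cnj by linarith
  qed
  thus ?thesis unfolding h2_inner_def by (rule summable_sums)
qed

lemma h2_inner_add_left:
  assumes "f \<in> hardy2" "h \<in> hardy2" "u \<in> hardy2"
  shows "h2_inner (\<lambda>z. f z + h z) u = h2_inner f u + h2_inner h u"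
  using sums_add[OF h2_inner_sums[OF assms(1,3)] h2_inner_sums[OF assms(2,3)]]
    h2_inner_sums[OF hardy2_add[OF assms(1,2)] assms(3)]
  by (simp add: taylor_coeff_add assms algebra_simps sums_unique2)

lemma h2_inner_cmult_left:
  assumes "f \<in> hardy2" "u \<in> hardy2"
  shows "h2_inner (\<lambda>z. c * f z) u = c * h2_inner f u"
  using sums_mult[OF h2_inner_sums[OF assms], of c]
    h2_inner_sums[OF hardy2_cmult[OF assms(1)] assms(2), of c]
  by (simp add: taylor_coeff_cmult assms mult.assoc sums_unique2)

lemma h2_inner_commute:
  assumes "f \<in> hardy2" "h \<in> hardy2"
  shows "h2_inner h f = cnj (h2_inner f h)"
  using iffD2[OF sums_cnj h2_inner_sums[OF assms]] h2_inner_sums[OF assms(2,1)]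
  by (simp add: mult.commute sums_unique2)

lemma h2_inner_diff_left:
  assumes "f \<in> hardy2" "h \<in> hardy2" "u \<in> hardy2"
  shows "h2_inner (\<lambda>z. f z - h z) u = h2_inner f u - h2_inner h u"
  using h2_inner_add_left[OF assms(1) hardy2_cmult[OF assms(2), of "-1"] assms(3)]
    h2_inner_cmult_left[OF assms(2,3), of "-1"] by simp

lemma h2_inner_cmult_right:
  assumes "f \<in> hardy2" "u \<in> hardy2"
  shows "h2_inner u (\<lambda>z. c * f z) = cnj c * h2_inner u f"
  using assms by (simp add: h2_inner_commute[of _ u] hardy2_cmult h2_inner_cmult_left)

lemma h2_inner_add_right:
  assumes "f \<in> hardy2" "h \<in> hardy2" "u \<in> hardy2"
  shows "h2_inner u (\<lambda>z. f z + h z) = h2_inner u f + h2_inner u h"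
  using assms by (simp add: h2_inner_commute[of _ u] hardy2_add h2_inner_add_left)

lemma h2_inner_diff_right:
  assumes "f \<in> hardy2" "h \<in> hardy2" "u \<in> hardy2"
  shows "h2_inner u (\<lambda>z. f z - h z) = h2_inner u f - h2_inner u h"
  using assms by (simp add: h2_inner_commute[of _ u] hardy2_diff h2_inner_diff_left)

lemma h2_norm_nonneg [simp]: "h2_norm f \<ge> 0" if "f \<in> hardy2"
  unfolding h2_norm_def using hardy2D(3)[OF that] by (simp add: suminf_nonneg)

lemma h2_norm_sq_sums:
  assumes "f \<in> hardy2"
  shows "(\<lambda>n. (cmod (taylor_coeff f n))\<^sup>2) sums (h2_norm f)\<^sup>2"
  unfolding h2_norm_def using hardy2D(3)[OF assms]
  by (simp add: suminf_nonneg summable_sums)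

lemma h2_inner_self:
  assumes "f \<in> hardy2"
  shows "h2_inner f f = of_real ((h2_norm f)\<^sup>2)"
proof -
  have "(\<lambda>n. of_real ((cmod (taylor_coeff f n))\<^sup>2) :: complex) sums of_real ((h2_norm f)\<^sup>2)"
    by (rule sums_of_real[OF h2_norm_sq_sums[OF assms]])
  thus ?thesis using h2_inner_sums[OF assms assms]
    by (simp only: complex_norm_square sums_unique2)
qed

lemma h2_norm_add_sq:
  assumes "f \<in> hardy2" "h \<in> hardy2"
  shows "(h2_norm (\<lambda>z. f z + h z))\<^sup>2 = (h2_norm f)\<^sup>2 + (h2_norm h)\<^sup>2 + 2 * Re (h2_inner f h)"
proof -
  have "complex_of_real ((h2_norm (\<lambda>z. f z + h z))\<^sup>2) =
      of_real ((h2_norm f)\<^sup>2) + of_real ((h2_norm h)\<^sup>2) + h2_inner f h + cnj (h2_inner f h)"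
    using assms
    by (simp only: h2_inner_self[symmetric] hardy2_add h2_inner_add_left h2_inner_add_right
        h2_inner_commute[of f h, symmetric]) simp
  from arg_cong[OF this, of Re] show ?thesis by simp
qed

lemma sum_coeff_le_h2_norm:
  assumes "f \<in> hardy2" "finite A"
  shows "L2_set (\<lambda>n. cmod (taylor_coeff f n)) A \<le> h2_norm f"
  unfolding L2_set_def h2_norm_def
  by (intro real_sqrt_le_mono sum_le_suminf hardy2D assms) auto

lemma h2_Cauchy_Schwarz:
  assumes "f \<in> hardy2" "h \<in> hardy2"
  shows "cmod (h2_inner f h) \<le> h2_norm f * h2_norm h"
proof (rule LIMSEQ_le_const2)
  show "(\<lambda>N. cmod (\<Sum>n<N. taylor_coeff f n * cnj (taylor_coeff h n))) \<longlonglongrightarrow> cmod (h2_inner f h)"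
    using h2_inner_sums[OF assms] unfolding sums_def by (rule tendsto_norm)
  have "cmod (\<Sum>n<N. taylor_coeff f n * cnj (taylor_coeff h n)) \<le> h2_norm f * h2_norm h" for N
  proof -
    have "cmod (\<Sum>n<N. taylor_coeff f n * cnj (taylor_coeff h n)) \<le>
        (\<Sum>n<N. \<bar>cmod (taylor_coeff f n)\<bar> * \<bar>cmod (taylor_coeff h n)\<bar>)"
      by (rule order.trans[OF norm_sum]) (simp add: norm_mult)
    also have "\<dots> \<le> L2_set (\<lambda>n. cmod (taylor_coeff f n)) {..<N} * L2_set (\<lambda>n. cmod (taylor_coeff h n)) {..<N}"
      by (rule L2_set_mult_ineq)
    also have "\<dots> \<le> h2_norm f * h2_norm h"
      by (intro mult_mono sum_coeff_le_h2_norm h2_norm_nonneg L2_set_nonneg assms) auto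
    finally show ?thesis .
  qed
  thus "\<exists>N. \<forall>n\<ge>N. cmod (\<Sum>n<n. taylor_coeff f n * cnj (taylor_coeff h n)) \<le> h2_norm f * h2_norm h"
    by blast
qed

lemma h2_norm_triangle:
  assumes "f \<in> hardy2" "h \<in> hardy2"
  shows "h2_norm (\<lambda>z. f z + h z) \<le> h2_norm f + h2_norm h"
proof (rule power2_le_imp_le)
  show "(h2_norm (\<lambda>z. f z + h z))\<^sup>2 \<le> (h2_norm f + h2_norm h)\<^sup>2"
    using h2_norm_add_sq[OF assms] h2_Cauchy_Schwarz[OF assms] complex_Re_le_cmod[of "h2_inner f h"]
    by (simp add: power2_sum)
qed (use assms in auto)

lemma h2_norm_cmult:
  assumes "f \<in> hardy2"
  shows "h2_norm (\<lambda>z. c * f z) = cmod c * h2_norm f"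
  using hardy2D(3)[OF assms]
  by (simp add: h2_norm_def taylor_coeff_cmult assms norm_mult power_mult_distrib
      suminf_mult real_sqrt_mult)

lemma h2_norm_minus_commute:
  assumes "f \<in> hardy2" "h \<in> hardy2"
  shows "h2_norm (\<lambda>z. f z - h z) = h2_norm (\<lambda>z. h z - f z)"
  using h2_norm_cmult[OF hardy2_diff[OF assms], of "-1"] by simp

lemma h2_norm_eq_0:
  assumes "f \<in> hardy2" "h2_norm f = 0"
  shows "f z = 0"
proof (cases "z \<in> unit_disc")
  case True
  have "taylor_coeff f n = 0" for n
    using sum_coeff_le_h2_norm[OF assms(1), of "{n}"] assms(2) by simp
  with hardy2D(4)[OF assms(1) True] show ?thesis
    by (simp add: sums_iff)
qed (use hardy2D(2)[OF assms(1)] in blast)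

text \<open>
  The rate \<open>R\<close> is kept explicit because the gliding hump argument below needs the distance of the
  limit from each member of the sequence. The limit is built coefficientwise: the estimate
  passes to the limit in every finite block of coefficients, and then to the whole norm.
\<close>

lemma hardy2_complete:
  assumes F: "\<And>n. F n \<in> hardy2"
    and R: "\<And>m n. n \<le> m \<Longrightarrow> h2_norm (\<lambda>z. F m z - F n z) \<le> R n" "R \<longlonglongrightarrow> 0"
  obtains f where "f \<in> hardy2" "\<And>n. h2_norm (\<lambda>z. f z - F n z) \<le> R n"
proof -
  define a where "a n k = taylor_coeff (F n) k" for n k
  have L2: "L2_set (\<lambda>k. cmod (a m k - a n k)) A \<le> R n" if "n \<le> m" "finite A" for m n A
    using sum_coeff_le_h2_norm[OF hardy2_diff[OF F[of m] F[of n]] that(2)] R(1)[OF that(1)]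
    by (simp add: taylor_coeff_diff F a_def)
  have "Cauchy (\<lambda>n. a n k)" for k
  proof (rule CauchyI')
    fix e :: real assume "e > 0"
    hence "eventually (\<lambda>n. R n < e) sequentially"
      using R(2) by (auto simp: order_tendsto_iff)
    then obtain N where N: "R n < e" if "n \<ge> N" for n by (auto simp: eventually_sequentially)
    show "\<exists>M. \<forall>m\<ge>M. \<forall>n>m. dist (a m k) (a n k) < e"
    proof (intro exI allI impI)
      fix m n assume "m \<ge> N" "n > m"
      thus "dist (a m k) (a n k) < e"
        using L2[of m n "{k}"] N[of m] by (simp add: dist_norm norm_minus_commute)
    qed
  qed
  hence "\<exists>l. (\<lambda>n. a n k) \<longlonglongrightarrow> l" for k
    by (meson Cauchy_convergent_iff convergent_def)
  then obtain l where l: "(\<lambda>n. a n k) \<longlonglongrightarrow> l k" for k by metis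
  have L2l: "L2_set (\<lambda>k. cmod (l k - a n k)) A \<le> R n" if "finite A" for n A
  proof (rule LIMSEQ_le_const2)
    show "(\<lambda>m. L2_set (\<lambda>k. cmod (a m k - a n k)) A) \<longlonglongrightarrow> L2_set (\<lambda>k. cmod (l k - a n k)) A"
      unfolding L2_set_def by (intro tendsto_intros l)
    show "\<exists>N. \<forall>m\<ge>N. L2_set (\<lambda>k. cmod (a m k - a n k)) A \<le> R n"
      using L2 that by blast
  qed
  have R0: "R n \<ge> 0" for n using L2[of n n "{}"] by simp
  have part: "(\<Sum>k<N. (cmod (l k - a n k))\<^sup>2) \<le> (R n)\<^sup>2" for n N
    using L2l[of "{..<N}" n] R0[of n]
    by (simp add: L2_set_def sqrt_le_D)
  have sd: "summable (\<lambda>k. (cmod (l k - a n k))\<^sup>2)" for n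
    by (rule bounded_imp_summable[of _ "(R n)\<^sup>2"])
      (simp, metis part lessThan_Suc_atMost)
  have "summable (\<lambda>k. (cmod (l k - a 0 k + a 0 k))\<^sup>2)"
    by (rule summable_add_sq) (use sd hardy2D(3)[OF F] in \<open>auto simp: a_def\<close>)
  hence sl: "summable (\<lambda>k. (cmod (l k))\<^sup>2)" by simp
  define f where "f z = (if z \<in> unit_disc then \<Sum>k. l k * z ^ k else 0)" for z
  have fs: "(\<lambda>k. l k * z ^ k) sums f z" if "z \<in> unit_disc" for z
  proof -
    have "(\<lambda>k. (cmod (l k))\<^sup>2) \<longlonglongrightarrow> 0" by (rule summable_LIMSEQ_zero[OF sl])
    hence "(\<lambda>k. sqrt ((cmod (l k))\<^sup>2)) \<longlonglongrightarrow> sqrt 0" by (rule tendsto_real_sqrt)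
    hence "Bseq (\<lambda>k. cmod (l k))" by (intro convergent_imp_Bseq) (auto simp: convergent_def)
    then obtain B where B: "\<And>k. cmod (l k) \<le> B" by (auto simp: Bseq_def)
    have "summable (\<lambda>k. l k * z ^ k)"
    proof (rule summable_comparison_test')
      show "summable (\<lambda>k. B * cmod z ^ k)"
        using that by (intro summable_mult summable_geometric) auto
      show "norm (l k * z ^ k) \<le> B * cmod z ^ k" for k
        using B[of k] by (simp add: norm_mult norm_power mult_right_mono)
    qed
    thus ?thesis using that by (simp add: f_def summable_sums)
  qed
  have f: "f \<in> hardy2"
    by (rule hardy2I[OF fs _ sl]) (auto simp: f_def)
  have tf: "taylor_coeff f = l" by (rule power_series_on_disc(2)[OF fs])
  have "h2_norm (\<lambda>z. f z - F n z) \<le> R n" for n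
    unfolding h2_norm_def using suminf_le_const[OF sd part] R0[of n]
    by (auto simp: taylor_coeff_diff f F tf simp flip: a_def intro!: real_le_lsqrt)
  with f show thesis by (rule that)
qed

section \<open>Mean squares over circles\<close>

abbreviation circ :: "real measure" where
  "circ \<equiv> restrict_space lborel {0..2 * pi}"

lemma finite_measure_circ: "finite_measure circ"
  by (rule finite_measureI) (simp add: emeasure_restrict_space)

lemma measurable_circ:
  fixes \<phi> :: "real \<Rightarrow> 'a :: topological_space"
  assumes "continuous_on UNIV \<phi>"
  shows "\<phi> \<in> borel_measurable circ"
  using borel_measurable_continuous_onI[OF assms] by (intro measurable_restrict_space1) simp

lemma integrable_circ:
  fixes \<phi> :: "real \<Rightarrow> 'a :: {banach, second_countable_topology}"
  assumes "continuous_on UNIV \<phi>" "\<And>t. norm (\<phi> t) \<le> B"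
  shows "integrable circ \<phi>"
  by (rule finite_measure.integrable_const_bound[OF finite_measure_circ, of _ B])
    (use assms in \<open>auto intro: measurable_circ\<close>)

text \<open>
  Orthogonality of the trigonometric monomials; the measure \<open>circ\<close> is not normalised, hence the
  factor \<open>2 * pi\<close> here and below.
\<close>

lemma integral_circ_cis:
  fixes k :: int
  shows "(\<integral>t. cis (of_int k * t) \<partial>circ) = (if k = 0 then 2 * pi else 0)"
proof -
  have *: "(\<integral>t. cis (of_int k * t) \<partial>circ) =
      (\<integral>t. indicator {0..2 * pi} t *\<^sub>R cis (of_int k * t) \<partial>lborel)"
    by (rule integral_restrict_space) auto
  show ?thesis
  proof (cases "k = 0")
    case True
    thus ?thesis unfolding * by (simp add: scaleR_conv_of_real)
  next
    case False
    have "(\<integral>t. indicator {0..2 * pi} t *\<^sub>R cis (of_int k * t) \<partial>lborel) =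
        cis (of_int k * (2 * pi)) / (\<i> * of_int k) - cis (of_int k * 0) / (\<i> * of_int k)"
    proof (rule integral_FTC_atLeastAtMost)
      show "((\<lambda>t. cis (of_int k * t) / (\<i> * of_int k)) has_vector_derivative cis (of_int k * x))
          (at x within {0..2 * pi})" for x
        unfolding has_vector_derivative_def
        by (auto intro!: derivative_eq_intros simp: False scaleR_conv_of_real field_simps)
    qed (auto intro!: continuous_intros)
    also have "cis (of_int k * (2 * pi)) = 1"
      using cis_multiple_2pi[of "of_int k"] by (simp add: mult.commute mult.left_commute)
    finally show ?thesis using False * by simp
  qed
qed

lemma Parseval_finite:
  fixes c :: "nat \<Rightarrow> complex"
  shows "(\<integral>t. (cmod (\<Sum>n<N. c n * cis (of_nat n * t)))\<^sup>2 \<partial>circ) = 2 * pi * (\<Sum>n<N. (cmod (c n))\<^sup>2)"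
proof -
  have sq: "complex_of_real ((cmod (\<Sum>n<N. c n * cis (of_nat n * t)))\<^sup>2) =
     (\<Sum>n<N. \<Sum>m<N. c n * cnj (c m) * cis (of_int (int n - int m) * t))" for t
    unfolding complex_norm_square cnj_sum sum_product complex_cnj_mult cis_cnj
    by (intro sum.cong refl) (simp add: cis_mult algebra_simps)
  have "complex_of_real (\<integral>t. (cmod (\<Sum>n<N. c n * cis (of_nat n * t)))\<^sup>2 \<partial>circ) =
     (\<integral>t. (\<Sum>n<N. \<Sum>m<N. c n * cnj (c m) * cis (of_int (int n - int m) * t)) \<partial>circ)"
    by (subst integral_complex_of_real[symmetric]) (simp only: sq)
  also have "\<dots> = (\<Sum>n<N. \<Sum>m<N. c n * cnj (c m) * (\<integral>t. cis (of_int (int n - int m) * t) \<partial>circ))"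
  proof -
    have int: "integrable circ (\<lambda>t. c n * cnj (c m) * cis (of_int (int n - int m) * t))" for n m
      by (rule integrable_circ[of _ "cmod (c n) * cmod (c m)"])
        (auto intro!: continuous_intros simp: norm_mult)
    show ?thesis
      by (simp only: Bochner_Integration.integral_sum Bochner_Integration.integrable_sum int
          integral_mult_right_zero)
  qed
  also have "\<dots> = (\<Sum>n<N. \<Sum>m<N. if m = n then 2 * pi * (c n * cnj (c n)) else 0)"
    by (intro sum.cong refl) (simp only: integral_circ_cis, auto)
  also have "\<dots> = of_real (2 * pi * (\<Sum>n<N. (cmod (c n))\<^sup>2))"
    by (simp add: sum.delta sum_distrib_left complex_norm_square del: of_real_power)
  finally show ?thesis by (simp only: of_real_eq_iff)
qed

text \<open>
  Strictly inside the disc the Taylor series converges absolutely, so its partial sums are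
  uniformly bounded on the circle and the finite identity passes to the limit.
\<close>

lemma Parseval_circle:
  assumes f: "f holomorphic_on unit_disc" and r: "0 \<le> r" "r < 1"
  shows "(\<lambda>n. 2 * pi * ((cmod (taylor_coeff f n))\<^sup>2 * r ^ (2 * n))) sums
      (\<integral>t. (cmod (f (of_real r * cis t)))\<^sup>2 \<partial>circ)"
proof -
  define c where "c n = taylor_coeff f n * of_real r ^ n" for n
  have "summable (\<lambda>n. taylor_coeff f n * of_real ((1 + r) / 2) ^ n)"
    using taylor_coeff_sums[OF f, of "of_real ((1 + r) / 2)"] r
    by (auto simp: sums_iff simp del: of_real_add of_real_divide)
  hence sc: "summable (\<lambda>n. cmod (c n))"
    unfolding c_def by (rule powser_insidea) (use r in \<open>auto simp del: of_real_add of_real_divide\<close>)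
  define B where "B = (\<Sum>n. cmod (c n))"
  have B: "cmod (\<Sum>n<N. c n * cis (of_nat n * t)) \<le> B" for N t
  proof -
    have "cmod (\<Sum>n<N. c n * cis (of_nat n * t)) \<le> (\<Sum>n<N. cmod (c n))"
      by (rule order.trans[OF norm_sum]) (simp add: norm_mult)
    also have "\<dots> \<le> B" unfolding B_def by (rule sum_le_suminf[OF sc]) auto
    finally show ?thesis .
  qed
  have lim: "(\<lambda>N. \<Sum>n<N. c n * cis (of_nat n * t)) \<longlonglongrightarrow> f (of_real r * cis t)" for t
  proof -
    have "c n * cis (of_nat n * t) = taylor_coeff f n * (of_real r * cis t) ^ n" for n
      unfolding power_mult_distrib Complex.DeMoivre c_def by simp
    thus ?thesis
      using taylor_coeff_sums[OF f, of "of_real r * cis t"] r by (simp add: sums_def norm_mult)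
  qed
  have cf: "continuous_on UNIV (\<lambda>t. f (of_real r * cis t))"
    by (rule continuous_on_compose2[OF holomorphic_on_imp_continuous_on[OF f]])
      (use r in \<open>auto intro!: continuous_intros simp: norm_mult\<close>)
  have "(\<lambda>N. \<integral>t. (cmod (\<Sum>n<N. c n * cis (of_nat n * t)))\<^sup>2 \<partial>circ) \<longlonglongrightarrow>
      (\<integral>t. (cmod (f (of_real r * cis t)))\<^sup>2 \<partial>circ)"
  proof (rule integral_dominated_convergence[where w = "\<lambda>_. B\<^sup>2"])
    show "AE t in circ. (\<lambda>N. (cmod (\<Sum>n<N. c n * cis (of_nat n * t)))\<^sup>2) \<longlonglongrightarrow>
        (cmod (f (of_real r * cis t)))\<^sup>2"
      by (intro AE_I2 tendsto_intros lim)
    show "integrable circ (\<lambda>_. B\<^sup>2)" by (rule integrable_circ) (auto intro!: continuous_intros)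
    show "AE t in circ. norm ((cmod (\<Sum>n<N. c n * cis (of_nat n * t)))\<^sup>2) \<le> B\<^sup>2" for N
      by (intro AE_I2) (use B in \<open>auto intro: power_mono\<close>)
  qed (auto intro!: measurable_circ continuous_intros cf)
  thus ?thesis
    unfolding Parseval_finite sums_def
    using r by (simp add: c_def norm_mult norm_power power_mult_distrib power_mult power2_eq_square
        sum_distrib_left algebra_simps)
qed

lemma sum_coeff_dilate_le_bound:
  fixes a :: "nat \<Rightarrow> real"
  assumes "\<And>r. 0 \<le> r \<Longrightarrow> r < 1 \<Longrightarrow> (\<Sum>n<N. a n * r ^ (2 * n)) \<le> C"
  shows "(\<Sum>n<N. a n) \<le> C"
proof (rule tendsto_upperbound)
  show "((\<lambda>r. \<Sum>n<N. a n * r ^ (2 * n)) \<longlongrightarrow> (\<Sum>n<N. a n)) (at_left (1::real))"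
    by (auto intro!: tendsto_eq_intros)
  show "\<forall>\<^sub>F r in at_left (1::real). (\<Sum>n<N. a n * r ^ (2 * n)) \<le> C"
    using eventually_at_left_real[of 0 1] by (auto elim!: eventually_mono intro!: assms)
qed auto

text \<open>
  By Parseval the squared norm is, up to the factor \<open>2 * pi\<close>, the supremum of the integrals of the
  squared modulus over the circles of radius \<open>r < 1\<close>, none of which a multiplier bounded by one
  increases.
\<close>

lemma
  assumes u: "u holomorphic_on unit_disc" "\<And>z. z \<in> unit_disc \<Longrightarrow> cmod (u z) \<le> 1"
    and f: "f \<in> hardy2"
  shows hardy2_mult_bounded: "(\<lambda>z. u z * f z) \<in> hardy2"
    and h2_norm_mult_bounded_le: "h2_norm (\<lambda>z. u z * f z) \<le> h2_norm f"
proof -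
  define b where "b = taylor_coeff (\<lambda>z. u z * f z)"
  have hol: "(\<lambda>z. u z * f z) holomorphic_on unit_disc"
    by (intro holomorphic_intros u hardy2D f)
  have *: "(\<Sum>n<N. (cmod (b n))\<^sup>2 * r ^ (2 * n)) \<le> (h2_norm f)\<^sup>2" if r: "0 \<le> r" "r < 1" for N r
  proof -
    let ?S = "\<integral>t. (cmod (f (of_real r * cis t)))\<^sup>2 \<partial>circ"
    have cont: "continuous_on UNIV (\<lambda>t. (cmod (h (of_real r * cis t)))\<^sup>2)"
      if "h holomorphic_on unit_disc" for h
      by (intro continuous_intros continuous_on_compose2[OF holomorphic_on_imp_continuous_on[OF that]])
        (use r in \<open>auto intro!: continuous_intros simp: norm_mult\<close>)
    have int: "integrable circ (\<lambda>t. (cmod (h (of_real r * cis t)))\<^sup>2)"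
      if "h holomorphic_on unit_disc" for h
    proof -
      have "integrable lborel (\<lambda>t. indicator {0..2 * pi} t *\<^sub>R (cmod (h (of_real r * cis t)))\<^sup>2)"
        by (rule borel_integrable_compact) (auto intro: continuous_on_subset[OF cont[OF that]])
      thus ?thesis by (subst integrable_restrict_space) auto
    qed
    have "2 * pi * (\<Sum>n<N. (cmod (b n))\<^sup>2 * r ^ (2 * n)) \<le>
        (\<integral>t. (cmod (u (of_real r * cis t) * f (of_real r * cis t)))\<^sup>2 \<partial>circ)"
      using sum_le_suminf[OF sums_summable[OF Parseval_circle[OF hol r]], of "{..<N}"]
        sums_unique[OF Parseval_circle[OF hol r]] r
      by (simp add: b_def sum_distrib_left)
    also have "\<dots> \<le> ?S"
    proof (rule integral_mono[OF int[OF hol] int[OF hardy2D(1)[OF f]]])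
      fix t
      have "cmod (u (of_real r * cis t)) \<le> 1" using r by (intro u) (simp add: norm_mult)
      thus "(cmod (u (of_real r * cis t) * f (of_real r * cis t)))\<^sup>2 \<le> (cmod (f (of_real r * cis t)))\<^sup>2"
        by (intro power_mono) (auto simp: norm_mult mult_left_le_one_le)
    qed
    also have "?S \<le> 2 * pi * (h2_norm f)\<^sup>2"
    proof (rule sums_le[OF _ Parseval_circle[OF hardy2D(1)[OF f] r] sums_mult[OF h2_norm_sq_sums[OF f]]])
      fix n
      show "2 * pi * ((cmod (taylor_coeff f n))\<^sup>2 * r ^ (2 * n)) \<le> 2 * pi * (cmod (taylor_coeff f n))\<^sup>2"
        using r power_le_one[of r "2 * n"] by (intro mult_left_mono mult_left_le) auto
    qed
    finally show ?thesis by simp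
  qed
  have part: "(\<Sum>n<N. (cmod (b n))\<^sup>2) \<le> (h2_norm f)\<^sup>2" for N
    by (rule sum_coeff_dilate_le_bound) (use * in blast)
  have sb: "summable (\<lambda>n. (cmod (b n))\<^sup>2)"
    by (rule bounded_imp_summable[of _ "(h2_norm f)\<^sup>2"]) (simp, metis part lessThan_Suc_atMost)
  thus H: "(\<lambda>z. u z * f z) \<in> hardy2"
    unfolding hardy2_def using hol hardy2D(2)[OF f] by (auto simp: b_def)
  show "h2_norm (\<lambda>z. u z * f z) \<le> h2_norm f"
    unfolding h2_norm_def[of "\<lambda>z. u z * f z"] b_def[symmetric]
    using suminf_le_const[OF sb part] f by (intro real_le_lsqrt) auto
qed

section \<open>Polynomials and multiplication by inner functions\<close>

definition disc_poly :: "(nat \<Rightarrow> complex) \<Rightarrow> nat \<Rightarrow> complex \<Rightarrow> complex" where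
  "disc_poly c N z = (if z \<in> unit_disc then \<Sum>n<N. c n * z ^ n else 0)"

lemma
  shows disc_poly_hardy2: "disc_poly c N \<in> hardy2"
    and taylor_coeff_disc_poly: "taylor_coeff (disc_poly c N) = (\<lambda>n. if n < N then c n else 0)"
proof -
  have s: "(\<lambda>n. (if n < N then c n else 0) * z ^ n) sums disc_poly c N z" if "z \<in> unit_disc" for z
    using sums_If_finite_set[of "{..<N}" "\<lambda>n. c n * z ^ n"] that
    by (simp add: disc_poly_def if_distrib[of "\<lambda>x. x * _"] cong: if_cong)
  have "summable (\<lambda>n. (cmod (if n < N then c n else 0))\<^sup>2)"
    by (rule summable_finite[of "{..<N}"]) auto
  thus "disc_poly c N \<in> hardy2"
    by (intro hardy2I[OF s]) (auto simp: disc_poly_def)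
  show "taylor_coeff (disc_poly c N) = (\<lambda>n. if n < N then c n else 0)"
    by (rule power_series_on_disc(2)[OF s])
qed

lemma h2_inner_disc_poly:
  assumes "h \<in> hardy2"
  shows "h2_inner (disc_poly c N) h = (\<Sum>n<N. c n * cnj (taylor_coeff h n))"
proof -
  have "h2_inner (disc_poly c N) h = (\<Sum>n. if n < N then c n * cnj (taylor_coeff h n) else 0)"
    unfolding h2_inner_def taylor_coeff_disc_poly by (intro suminf_cong) auto
  also have "\<dots> = (\<Sum>n<N. c n * cnj (taylor_coeff h n))"
    using sums_If_finite_set[of "{..<N}" "\<lambda>n. c n * cnj (taylor_coeff h n)"]
    by (simp add: sums_iff)
  finally show ?thesis .
qed

lemma h2_norm_disc_poly_sq: "(h2_norm (disc_poly c N))\<^sup>2 = (\<Sum>n<N. (cmod (c n))\<^sup>2)"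
proof -
  have "complex_of_real ((h2_norm (disc_poly c N))\<^sup>2) = of_real (\<Sum>n<N. (cmod (c n))\<^sup>2)"
    unfolding h2_inner_self[OF disc_poly_hardy2, symmetric] h2_inner_disc_poly[OF disc_poly_hardy2]
    by (simp add: taylor_coeff_disc_poly complex_norm_square del: of_real_power)
  thus ?thesis by (simp only: of_real_eq_iff)
qed

lemma h2_norm_diff_disc_poly:
  assumes "f \<in> hardy2"
  shows "(\<lambda>N. h2_norm (\<lambda>z. f z - disc_poly (taylor_coeff f) N z)) \<longlonglongrightarrow> 0"
proof -
  let ?a = "\<lambda>n. (cmod (taylor_coeff f n))\<^sup>2"
  have "(h2_norm (\<lambda>z. f z - disc_poly (taylor_coeff f) N z))\<^sup>2 = (h2_norm f)\<^sup>2 - (\<Sum>n<N. ?a n)" for N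
  proof -
    have "(\<lambda>n. ?a n - (if n \<in> {..<N} then ?a n else 0)) sums ((h2_norm f)\<^sup>2 - (\<Sum>n<N. ?a n))"
      by (intro sums_diff h2_norm_sq_sums assms sums_If_finite_set) auto
    moreover have "?a n - (if n \<in> {..<N} then ?a n else 0) =
        (cmod (taylor_coeff (\<lambda>z. f z - disc_poly (taylor_coeff f) N z) n))\<^sup>2" for n
      by (simp add: taylor_coeff_diff assms disc_poly_hardy2 taylor_coeff_disc_poly)
    ultimately show ?thesis
      using sums_unique2[OF h2_norm_sq_sums[OF hardy2_diff[OF assms disc_poly_hardy2]]] by simp
  qed
  hence eq: "h2_norm (\<lambda>z. f z - disc_poly (taylor_coeff f) N z) = sqrt ((h2_norm f)\<^sup>2 - (\<Sum>n<N. ?a n))" for N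
    by (metis abs_of_nonneg assms disc_poly_hardy2 h2_norm_nonneg hardy2_diff real_sqrt_abs)
  have "(\<lambda>N. sqrt ((h2_norm f)\<^sup>2 - (\<Sum>n<N. ?a n))) \<longlonglongrightarrow> sqrt ((h2_norm f)\<^sup>2 - (h2_norm f)\<^sup>2)"
    by (intro tendsto_intros h2_norm_sq_sums[OF assms, unfolded sums_def])
  thus ?thesis by (simp add: eq)
qed

text \<open>
  The mean square of \<open>I * p\<close> over the circle of radius \<open>r\<close> tends to that of \<open>p\<close> over the unit circle:
  a polynomial extends continuously to the closed disc, and the radial limits of \<open>I\<close> are
  unimodular almost everywhere. Dominated convergence applies since \<open>I\<close> is bounded. No boundary
  values of general Hardy functions enter, as the other functions are reached by density.
\<close>

lemma h2_norm_inner_mult_poly: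
  assumes I: "inner_function I"
  shows "h2_norm (disc_poly c N) \<le> h2_norm (\<lambda>z. I z * disc_poly c N z)"
proof -
  have hI: "I holomorphic_on unit_disc" and bI: "\<And>z. z \<in> unit_disc \<Longrightarrow> cmod (I z) \<le> 1"
    using I by (auto simp: inner_function_def)
  define P where "P z = (\<Sum>n<N. c n * z ^ n)" for z
  let ?F = "\<lambda>z. I z * disc_poly c N z"
  have F: "?F \<in> hardy2" by (rule hardy2_mult_bounded[OF hI bI disc_poly_hardy2])
  define r where "r k = 1 - inverse (real (Suc (Suc k)))" for k
  have r: "0 \<le> r k" "r k < 1" for k by (auto simp: r_def field_simps)
  have r1: "r \<longlonglongrightarrow> 1"
    unfolding r_def using LIMSEQ_inverse_real_of_nat_add_minus[of 1] LIMSEQ_Suc by fastforce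
  hence rl: "filterlim r (at_left 1) sequentially"
    unfolding filterlim_at using r by (auto simp: less_imp_neq)
  have le: "(\<integral>t. (cmod (?F (of_real (r k) * cis t)))\<^sup>2 \<partial>circ) \<le> 2 * pi * (h2_norm ?F)\<^sup>2" for k
  proof (rule sums_le[OF _ Parseval_circle[OF hardy2D(1)[OF F] r] sums_mult[OF h2_norm_sq_sums[OF F]]])
    fix n
    show "2 * pi * ((cmod (taylor_coeff ?F n))\<^sup>2 * r k ^ (2 * n)) \<le> 2 * pi * (cmod (taylor_coeff ?F n))\<^sup>2"
      using r[of k] power_le_one[of "r k" "2 * n"] by (intro mult_left_mono mult_left_le) auto
  qed
  have "AE t in lborel. t \<in> {0..2 * pi} \<longrightarrow>
     (\<lambda>k. (cmod (?F (of_real (r k) * cis t)))\<^sup>2) \<longlonglongrightarrow> (cmod (P (cis t)))\<^sup>2"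
    using I[unfolded inner_function_def, THEN conjunct2, THEN conjunct2]
  proof (rule AE_mp, intro AE_I2 impI)
    fix t assume "\<exists>w. cmod w = 1 \<and> ((\<lambda>r. I (of_real r * cis t)) \<longlongrightarrow> w) (at_left 1)"
    then obtain w where w: "cmod w = 1" "((\<lambda>r. I (of_real r * cis t)) \<longlongrightarrow> w) (at_left 1)" by blast
    have "(\<lambda>k. I (of_real (r k) * cis t)) \<longlonglongrightarrow> w"
      using filterlim_compose[OF w(2) rl] .
    hence "(\<lambda>k. (cmod (I (of_real (r k) * cis t) * P (of_real (r k) * cis t)))\<^sup>2) \<longlonglongrightarrow>
        (cmod (w * P (of_real 1 * cis t)))\<^sup>2"
      unfolding P_def by (intro tendsto_intros r1)
    thus "(\<lambda>k. (cmod (?F (of_real (r k) * cis t)))\<^sup>2) \<longlonglongrightarrow> (cmod (P (cis t)))\<^sup>2"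
      using r by (simp add: norm_mult w disc_poly_def P_def)
  qed
  hence AE: "AE t in circ. (\<lambda>k. (cmod (?F (of_real (r k) * cis t)))\<^sup>2) \<longlonglongrightarrow> (cmod (P (cis t)))\<^sup>2"
    by (subst AE_restrict_space_iff) auto
  have "(\<lambda>k. \<integral>t. (cmod (?F (of_real (r k) * cis t)))\<^sup>2 \<partial>circ) \<longlonglongrightarrow> (\<integral>t. (cmod (P (cis t)))\<^sup>2 \<partial>circ)"
  proof (rule integral_dominated_convergence[where w = "\<lambda>_. (\<Sum>n<N. cmod (c n))\<^sup>2", OF _ _ _ AE])
    show "(\<lambda>t. (cmod (P (cis t)))\<^sup>2) \<in> borel_measurable circ"
      unfolding P_def by (intro measurable_circ continuous_intros)
    show "(\<lambda>t. (cmod (?F (of_real (r k) * cis t)))\<^sup>2) \<in> borel_measurable circ" for k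
      by (intro measurable_circ continuous_intros
          continuous_on_compose2[OF holomorphic_on_imp_continuous_on[OF hardy2D(1)[OF F]]])
        (use r in \<open>auto intro!: continuous_intros simp: norm_mult\<close>)
    show "integrable circ (\<lambda>_. (\<Sum>n<N. cmod (c n))\<^sup>2)"
      by (rule integrable_circ) (auto intro!: continuous_intros)
    show "AE t in circ. norm ((cmod (?F (of_real (r k) * cis t)))\<^sup>2) \<le> (\<Sum>n<N. cmod (c n))\<^sup>2" for k
    proof (rule AE_I2)
      fix t
      have d: "of_real (r k) * cis t \<in> unit_disc" using r by (simp add: norm_mult)
      have "cmod (P (of_real (r k) * cis t)) \<le> (\<Sum>n<N. cmod (c n))"
        unfolding P_def
        by (rule order.trans[OF norm_sum], intro sum_mono)
          (use r[of k] in \<open>auto simp: norm_mult norm_power intro!: mult_left_le power_le_one\<close>)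
      hence "cmod (?F (of_real (r k) * cis t)) \<le> 1 * (\<Sum>n<N. cmod (c n))"
        unfolding norm_mult using bI[OF d] d by (intro mult_mono) (auto simp: disc_poly_def P_def)
      thus "norm ((cmod (?F (of_real (r k) * cis t)))\<^sup>2) \<le> (\<Sum>n<N. cmod (c n))\<^sup>2"
        by (auto intro: power_mono)
    qed
  qed
  hence "(\<integral>t. (cmod (P (cis t)))\<^sup>2 \<partial>circ) \<le> 2 * pi * (h2_norm ?F)\<^sup>2"
    using le by (intro LIMSEQ_le_const2) auto
  also have "(\<integral>t. (cmod (P (cis t)))\<^sup>2 \<partial>circ) = 2 * pi * (h2_norm (disc_poly c N))\<^sup>2"
    unfolding h2_norm_disc_poly_sq Parseval_finite[symmetric] P_def Complex.DeMoivre ..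
  finally have "(h2_norm (disc_poly c N))\<^sup>2 \<le> (h2_norm ?F)\<^sup>2" by simp
  thus ?thesis by (rule power2_le_imp_le) (rule h2_norm_nonneg[OF F])
qed

lemma inner_functionD:
  assumes "inner_function I"
  shows "I holomorphic_on unit_disc" "z \<in> unit_disc \<Longrightarrow> cmod (I z) \<le> 1"
  using assms by (auto simp: inner_function_def)

lemma hardy2_inner_mult:
  assumes "inner_function I" "f \<in> hardy2"
  shows "(\<lambda>z. I z * f z) \<in> hardy2"
  by (rule hardy2_mult_bounded[OF inner_functionD[OF assms(1)] assms(2)])

lemma h2_norm_inner_mult:
  assumes I: "inner_function I" and f: "f \<in> hardy2"
  shows "h2_norm (\<lambda>z. I z * f z) = h2_norm f"
proof (rule antisym)
  show "h2_norm (\<lambda>z. I z * f z) \<le> h2_norm f"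
    by (rule h2_norm_mult_bounded_le[OF inner_functionD[OF I] f])
  let ?p = "disc_poly (taylor_coeff f)"
  have "h2_norm f \<le> h2_norm (\<lambda>z. I z * f z) + 2 * h2_norm (\<lambda>z. f z - ?p N z)" for N
  proof -
    note [simp] = disc_poly_hardy2 f hardy2_inner_mult[OF I] hardy2_diff
    have "h2_norm f \<le> h2_norm (?p N) + h2_norm (\<lambda>z. f z - ?p N z)"
      using h2_norm_triangle[of "?p N" "\<lambda>z. f z - ?p N z"] by simp
    also have "h2_norm (?p N) \<le> h2_norm (\<lambda>z. I z * ?p N z)" by (rule h2_norm_inner_mult_poly[OF I])
    also have "\<dots> \<le> h2_norm (\<lambda>z. I z * f z) + h2_norm (\<lambda>z. I z * (?p N z - f z))"
      using h2_norm_triangle[of "\<lambda>z. I z * f z" "\<lambda>z. I z * (?p N z - f z)"] by (simp add: algebra_simps)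
    also have "h2_norm (\<lambda>z. I z * (?p N z - f z)) \<le> h2_norm (\<lambda>z. ?p N z - f z)"
      by (rule h2_norm_mult_bounded_le[OF inner_functionD[OF I]]) auto
    also have "\<dots> = h2_norm (\<lambda>z. f z - ?p N z)" by (rule h2_norm_minus_commute) auto
    finally show ?thesis by simp
  qed
  moreover have "(\<lambda>N. h2_norm (\<lambda>z. I z * f z) + 2 * h2_norm (\<lambda>z. f z - ?p N z)) \<longlonglongrightarrow>
     h2_norm (\<lambda>z. I z * f z) + 2 * 0"
    by (intro tendsto_intros h2_norm_diff_disc_poly f)
  ultimately show "h2_norm f \<le> h2_norm (\<lambda>z. I z * f z)"
    by (intro LIMSEQ_le_const[of _ "h2_norm (\<lambda>z. I z * f z)"]) auto
qed

text \<open>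
  Polarisation. The set \<open>V\<close> is the whole Hardy space when the multiplier is inner, and a model
  space when it is the extremal function, which need not be bounded.
\<close>

lemma h2_inner_isometric_mult:
  assumes V: "\<And>f. f \<in> V \<Longrightarrow> f \<in> hardy2"
    and add: "\<And>f h. f \<in> V \<Longrightarrow> h \<in> V \<Longrightarrow> (\<lambda>z. f z + h z) \<in> V"
    and cmult: "\<And>c f. f \<in> V \<Longrightarrow> (\<lambda>z. c * f z) \<in> V"
    and u: "\<And>f. f \<in> V \<Longrightarrow> (\<lambda>z. u z * f z) \<in> hardy2"
    and iso: "\<And>f. f \<in> V \<Longrightarrow> h2_norm (\<lambda>z. u z * f z) = h2_norm f"
    and f: "f \<in> V" and h: "h \<in> V"
  shows "h2_inner (\<lambda>z. u z * f z) (\<lambda>z. u z * h z) = h2_inner f h"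
proof -
  have Re: "Re (h2_inner (\<lambda>z. u z * f z) (\<lambda>z. u z * k z)) = Re (h2_inner f k)" if k: "k \<in> V" for k
  proof -
    have "h2_norm (\<lambda>z. u z * f z + u z * k z) = h2_norm (\<lambda>z. f z + k z)"
      using iso[OF add[OF f k]] by (simp add: algebra_simps)
    thus ?thesis
      using h2_norm_add_sq[OF u[OF f] u[OF k]] h2_norm_add_sq[OF V[OF f] V[OF k]] iso[OF f] iso[OF k]
      by simp
  qed
  have "(\<lambda>z. u z * (\<i> * h z)) = (\<lambda>z. \<i> * (u z * h z))" by (simp add: fun_eq_iff)
  hence "Im (h2_inner (\<lambda>z. u z * f z) (\<lambda>z. u z * h z)) = Im (h2_inner f h)"
    using Re[OF cmult[OF h, of \<i>]] by (simp add: h2_inner_cmult_right V u f h)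
  with Re[OF h] show ?thesis by (simp add: complex_eq_iff)
qed

lemma h2_inner_inner_mult:
  assumes "inner_function I" "f \<in> hardy2" "h \<in> hardy2"
  shows "h2_inner (\<lambda>z. I z * f z) (\<lambda>z. I z * h z) = h2_inner f h"
  by (rule h2_inner_isometric_mult[of hardy2])
    (use assms in \<open>auto intro: hardy2_add hardy2_cmult hardy2_inner_mult h2_norm_inner_mult\<close>)

section \<open>Model spaces and their kernels\<close>

definition szego :: "complex \<Rightarrow> complex \<Rightarrow> complex" where
  "szego w z = (if z \<in> unit_disc then 1 / (1 - cnj w * z) else 0)"

lemma
  assumes w: "w \<in> unit_disc"
  shows szego_hardy2: "szego w \<in> hardy2"
    and taylor_coeff_szego: "taylor_coeff (szego w) = (\<lambda>n. cnj w ^ n)"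
proof -
  have s: "(\<lambda>n. cnj w ^ n * z ^ n) sums szego w z" if "z \<in> unit_disc" for z
  proof -
    have "cmod (cnj w * z) < 1" using w that mult_strict_mono[of "cmod w" 1 "cmod z" 1]
      by (simp add: norm_mult)
    thus ?thesis using geometric_sums[of "cnj w * z"] that by (simp add: szego_def power_mult_distrib)
  qed
  have "(cmod w)\<^sup>2 < 1" using w by (simp add: abs_square_less_1)
  hence "summable (\<lambda>n. (cmod (cnj w ^ n))\<^sup>2)"
    by (simp add: norm_power power_mult[symmetric] mult.commute[of _ 2])
      (simp add: power_mult summable_geometric)
  thus "szego w \<in> hardy2" by (intro hardy2I[OF s]) (auto simp: szego_def)
  show "taylor_coeff (szego w) = (\<lambda>n. cnj w ^ n)" by (rule power_series_on_disc(2)[OF s])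
qed

lemma h2_inner_szego:
  assumes "f \<in> hardy2" "w \<in> unit_disc"
  shows "h2_inner f (szego w) = f w"
  using hardy2D(4)[OF assms] by (simp add: h2_inner_def taylor_coeff_szego[OF assms(2)] sums_iff)

lemma model_spaceD:
  assumes "f \<in> model_space I"
  shows "f \<in> hardy2" "h \<in> hardy2 \<Longrightarrow> h2_inner f (\<lambda>z. I z * h z) = 0"
  using assms by (auto simp: model_space_def)

lemma model_space_add:
  assumes "inner_function I" "f \<in> model_space I" "h \<in> model_space I"
  shows "(\<lambda>z. f z + h z) \<in> model_space I"
  using assms by (auto simp: model_space_def hardy2_add h2_inner_add_left hardy2_inner_mult)

lemma model_space_cmult:
  assumes "inner_function I" "f \<in> model_space I"
  shows "(\<lambda>z. c * f z) \<in> model_space I"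
  using assms by (auto simp: model_space_def hardy2_cmult h2_inner_cmult_left hardy2_inner_mult)

lemma model_space_diff:
  assumes "inner_function I" "f \<in> model_space I" "h \<in> model_space I"
  shows "(\<lambda>z. f z - h z) \<in> model_space I"
  using assms by (auto simp: model_space_def hardy2_diff h2_inner_diff_left hardy2_inner_mult)

definition model_kernel :: "(complex \<Rightarrow> complex) \<Rightarrow> complex \<Rightarrow> complex \<Rightarrow> complex" where
  "model_kernel I w z = szego w z - cnj (I w) * (I z * szego w z)"

text \<open>
  Both claims hold because multiplication by \<open>I\<close> preserves inner products, so that
  \<open>h2_inner (I * s) (I * h) = h2_inner s h\<close> for the Szego kernel \<open>s\<close>: the two terms of the kernel
  cancel against \<open>I * h\<close>, while the second one does not contribute on the model space.
\<close>

lemma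
  assumes I: "inner_function I" and w: "w \<in> unit_disc"
  shows model_kernel_in: "model_kernel I w \<in> model_space I"
    and h2_inner_model_kernel: "f \<in> model_space I \<Longrightarrow> h2_inner f (model_kernel I w) = f w"
proof -
  let ?s = "szego w"
  note [simp] = szego_hardy2[OF w] hardy2_inner_mult[OF I] hardy2_cmult hardy2_diff
  have k: "model_kernel I w = (\<lambda>z. ?s z - cnj (I w) * (I z * ?s z))"
    by (simp add: fun_eq_iff model_kernel_def)
  have s: "h2_inner ?s h = cnj (h w)" if "h \<in> hardy2" for h
    using that w by (simp add: h2_inner_commute[of h ?s] h2_inner_szego)
  show "model_kernel I w \<in> model_space I"
    unfolding model_space_def k
    by (auto simp: h2_inner_diff_left h2_inner_cmult_left s h2_inner_inner_mult[OF I])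
  assume f: "f \<in> model_space I"
  show "h2_inner f (model_kernel I w) = f w"
    using model_spaceD[OF f] unfolding k
    by (simp add: h2_inner_diff_right h2_inner_cmult_right h2_inner_szego[OF _ w])
qed

lemma taylor_coeff_mult:
  assumes "u holomorphic_on unit_disc" "f holomorphic_on unit_disc"
  shows "taylor_coeff (\<lambda>z. u z * f z) n = (\<Sum>i\<le>n. taylor_coeff u i * taylor_coeff f (n - i))"
proof -
  have "taylor_coeff (\<lambda>z. u z * f z) n =
     (\<Sum>i\<le>n. of_nat (n choose i) * (deriv ^^ i) u 0 * (deriv ^^ (n - i)) f 0 / fact n)"
    unfolding taylor_coeff_def
    by (subst higher_deriv_mult[OF assms]) (auto simp: sum_divide_distrib atMost_atLeast0)
  also have "\<dots> = (\<Sum>i\<le>n. taylor_coeff u i * taylor_coeff f (n - i))"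
    by (intro sum.cong refl) (simp add: taylor_coeff_def binomial_fact)
  finally show ?thesis .
qed

text \<open>
  The polynomial \<open>q\<close> below is the image of the Taylor polynomial \<open>p\<close> of \<open>h\<close> under the adjoint of
  multiplication by \<open>I\<close>, so \<open>p - I * q\<close> is the orthogonal projection of \<open>p\<close> onto the model space. As
  projections are contractive and fix \<open>h\<close>, it is at least as close to \<open>h\<close> as \<open>p\<close> is.
\<close>

lemma model_space_dense:
  assumes I: "inner_function I" and h: "h \<in> model_space I" and e: "e > 0"
  obtains k P Q where "k \<in> model_space I" "h2_norm (\<lambda>z. h z - k z) < e"
    "continuous_on UNIV P" "continuous_on UNIV Q" "\<And>z. z \<in> unit_disc \<Longrightarrow> k z = P z - I z * Q z"
proof -
  note hH = model_spaceD(1)[OF h]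
  have "\<forall>\<^sub>F N in sequentially. h2_norm (\<lambda>z. h z - disc_poly (taylor_coeff h) N z) < e"
    using h2_norm_diff_disc_poly[OF hH] e by (auto simp: order_tendsto_iff)
  then obtain N where N: "h2_norm (\<lambda>z. h z - disc_poly (taylor_coeff h) N z) < e"
    by (auto simp: eventually_sequentially)
  define c where "c = taylor_coeff h"
  define d where "d j = (\<Sum>n<N. if j \<le> n then c n * cnj (taylor_coeff I (n - j)) else 0)" for j
  define p q where "p = disc_poly c N" and "q = disc_poly d N"
  define k where "k z = p z - I z * q z" for z
  have pq [simp]: "p \<in> hardy2" "q \<in> hardy2" unfolding p_def q_def by (rule disc_poly_hardy2)+
  note [simp] = hardy2_inner_mult[OF I] hardy2_diff hH
  \<comment> \<open>The coefficients of \<open>I\<close> and \<open>u\<close> enter through a Cauchy product, so that only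
    those of index below \<open>N\<close> matter; this is why \<open>q\<close> is again a polynomial.\<close>
  have adj: "h2_inner p (\<lambda>z. I z * u z) = h2_inner q u" if u: "u \<in> hardy2" for u
  proof -
    have "h2_inner p (\<lambda>z. I z * u z) =
       (\<Sum>n<N. \<Sum>i\<le>n. c n * cnj (taylor_coeff I (n - i)) * cnj (taylor_coeff u i))"
      unfolding p_def h2_inner_disc_poly[OF hardy2_inner_mult[OF I u]]
    proof (intro sum.cong refl)
      fix n
      have "(\<lambda>z. I z * u z) = (\<lambda>z. u z * I z)" by (simp add: mult.commute)
      thus "c n * cnj (taylor_coeff (\<lambda>z. I z * u z) n) =
          (\<Sum>i\<le>n. c n * cnj (taylor_coeff I (n - i)) * cnj (taylor_coeff u i))"
        by (simp only: taylor_coeff_mult[OF hardy2D(1)[OF u] inner_functionD(1)[OF I]])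
          (simp add: sum_distrib_left mult_ac)
    qed
    also have "\<dots> = (\<Sum>n<N. \<Sum>i<N. if i \<le> n then c n * cnj (taylor_coeff I (n - i)) * cnj (taylor_coeff u i) else 0)"
      by (intro sum.cong refl sum.mono_neutral_cong_left) auto
    also have "\<dots> = (\<Sum>i<N. d i * cnj (taylor_coeff u i))"
      unfolding d_def sum_distrib_right
      by (subst sum.swap) (intro sum.cong refl, simp)
    also have "\<dots> = h2_inner q u" unfolding q_def h2_inner_disc_poly[OF u] ..
    finally show ?thesis .
  qed
  have kH: "k \<in> hardy2" unfolding k_def by simp
  have k: "k \<in> model_space I"
    unfolding model_space_def using kH
    by (auto simp: k_def[abs_def] h2_inner_diff_left adj h2_inner_inner_mult[OF I])
  have "h2_inner (\<lambda>z. h z - k z) (\<lambda>z. - 1 * (I z * q z)) = 0"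
    using model_spaceD(2)[OF model_space_diff[OF I h k], of q] kH
    by (subst h2_inner_cmult_right) auto
  moreover have "(\<lambda>z. h z - p z) = (\<lambda>z. (h z - k z) + - 1 * (I z * q z))"
    by (simp add: k_def)
  moreover have "(\<lambda>z. - 1 * (I z * q z)) \<in> hardy2" by (intro hardy2_cmult) simp
  \<comment> \<open>Pythagoras: \<open>h - k\<close> lies in the model space and is orthogonal to \<open>I * q\<close>.\<close>
  ultimately have "(h2_norm (\<lambda>z. h z - k z))\<^sup>2 \<le> (h2_norm (\<lambda>z. h z - p z))\<^sup>2"
    using h2_norm_add_sq[of "\<lambda>z. h z - k z" "\<lambda>z. - 1 * (I z * q z)"] kH
    by (simp del: mult_minus1 mult_minus_left)
  hence "h2_norm (\<lambda>z. h z - k z) \<le> h2_norm (\<lambda>z. h z - p z)"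
    by (rule power2_le_imp_le) auto
  also have "\<dots> < e" using N by (simp add: p_def c_def)
  finally have "h2_norm (\<lambda>z. h z - k z) < e" .
  thus thesis
    by (rule that[OF k, of "\<lambda>z. \<Sum>n<N. c n * z ^ n" "\<lambda>z. \<Sum>n<N. d n * z ^ n"])
      (auto simp: k_def p_def q_def disc_poly_def intro!: continuous_intros)
qed

section \<open>The uniform boundedness principle\<close>

lemma closed_subspaceD:
  assumes "closed_subspace_h2 M"
  shows "f \<in> M \<Longrightarrow> f \<in> hardy2" "(\<lambda>_. 0) \<in> M"
    "f \<in> M \<Longrightarrow> h \<in> M \<Longrightarrow> (\<lambda>z. f z + h z) \<in> M"
    "f \<in> M \<Longrightarrow> (\<lambda>z. c * f z) \<in> M"
    "(\<And>n. F n \<in> M) \<Longrightarrow> f \<in> hardy2 \<Longrightarrow>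
       (\<lambda>n. h2_norm (\<lambda>z. F n z - f z)) \<longlonglongrightarrow> 0 \<Longrightarrow> f \<in> M"
  using assms unfolding closed_subspace_h2_def by blast+

text \<open>
  A gliding hump argument. If the functionals \<open>u n\<close> in \<open>U\<close> have norms above \<open>2 * n * 3 ^ Suc n\<close>,
  take \<open>v n\<close> to be the multiple of \<open>u n\<close> with norm \<open>inverse (3 ^ Suc n)\<close>. A series of terms \<open>s n * v n\<close>
  with unimodular \<open>s n\<close> converges to an \<open>f\<close> on which the functionals are unbounded: the factor \<open>s n\<close> is
  chosen so that adding the \<open>n\<close>-th term makes the \<open>n\<close>-th functional large, and the norms of all later
  terms add up to only half the norm of that term, so they cannot undo this.
\<close>

lemma uniform_boundedness_h2:
  assumes M: "closed_subspace_h2 M" and U: "U \<subseteq> M"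
    and bdd: "\<And>f. f \<in> M \<Longrightarrow> bdd_above ((\<lambda>u. cmod (h2_inner f u)) ` U)"
  shows "bdd_above (h2_norm ` U)"
proof (rule ccontr)
  assume unb: "\<not> bdd_above (h2_norm ` U)"
  have large: "\<exists>w. w \<in> U \<and> h2_norm w > C" for C
    using unb by (auto simp: bdd_above_def not_le)
  have "\<forall>n. \<exists>w. w \<in> U \<and> h2_norm w > 2 * real n * 3 ^ Suc n"
    by (intro allI large)
  from choice[OF this]
  obtain u where u: "\<And>n. u n \<in> U" "\<And>n. h2_norm (u n) > 2 * real n * 3 ^ Suc n" by blast
  have uM: "u n \<in> M" for n using u(1) U by blast
  note H = closed_subspaceD(1)[OF M]
  have upos: "h2_norm (u n) > 0" for n
    by (rule le_less_trans[OF _ u(2)]) simp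
  define v where "v n z = of_real (inverse (3 ^ Suc n * h2_norm (u n))) * u n z" for n z
  have vM: "v n \<in> M" for n
    unfolding v_def[abs_def] by (rule closed_subspaceD(4)[OF M uM])
  have vnorm: "h2_norm (v n) = inverse (3 ^ Suc n)" for n
    using upos[of n] unfolding v_def[abs_def] h2_norm_cmult[OF H[OF uM]] norm_of_real
    by (simp add: field_simps)
  have vu: "cmod (h2_inner (v n) (u n)) = h2_norm (u n) / 3 ^ Suc n" for n
    using upos[of n] unfolding v_def[abs_def] h2_inner_cmult_left[OF H[OF uM] H[OF uM]] h2_inner_self[OF H[OF uM]]
      norm_mult norm_of_real
    by (simp add: field_simps power2_eq_square)
  have step: "\<exists>s. cmod s = 1 \<and> cmod (h2_inner (\<lambda>z. x z + s * v n z) (u n)) \<ge> h2_norm (u n) / 3 ^ Suc n"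
    if x: "x \<in> M" for x n
  proof -
    let ?a = "h2_inner x (u n)" and ?b = "h2_inner (v n) (u n)"
    have e: "h2_inner (\<lambda>z. x z + s * v n z) (u n) = ?a + s * ?b" for s
      by (subst h2_inner_add_left) (auto intro: H x vM uM hardy2_cmult simp: h2_inner_cmult_left H vM uM)
    have "2 * cmod ?b = cmod ((?a + ?b) - (?a - ?b))" by (simp add: norm_mult)
    also have "\<dots> \<le> cmod (?a + ?b) + cmod (?a - ?b)" by (rule norm_triangle_ineq4)
    finally have "cmod (?a + 1 * ?b) \<ge> cmod ?b \<or> cmod (?a + (- 1) * ?b) \<ge> cmod ?b" by auto
    thus ?thesis unfolding e vu[symmetric] by (metis norm_minus_cancel norm_one)
  qed
  \<comment> \<open>The unimodular factor that makes the new functional large at the point \<open>x\<close> reached so far.\<close>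
  define S where "S x n = (SOME s. cmod s = 1 \<and>
     cmod (h2_inner (\<lambda>z. x z + s * v n z) (u n)) \<ge> h2_norm (u n) / 3 ^ Suc n)" for x n
  have S: "cmod (S x n) = 1"
    "cmod (h2_inner (\<lambda>z. x z + S x n * v n z) (u n)) \<ge> h2_norm (u n) / 3 ^ Suc n" if "x \<in> M" for x n
    using someI_ex[OF step[OF that, of n]] unfolding S_def by blast+
  define X where "X = rec_nat (\<lambda>_. 0) (\<lambda>n x z. x z + S x n * v n z)"
  have X_Suc: "X (Suc n) = (\<lambda>z. X n z + S (X n) n * v n z)" for n by (simp add: X_def)
  have XM: "X n \<in> M" for n
    by (induction n)
      (auto simp: X_Suc simp: X_def closed_subspaceD(2)[OF M] intro!: closed_subspaceD(3,4)[OF M] vM)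
  \<comment> \<open>The sum of the norms of all terms from the \<open>n\<close>-th one on.\<close>
  define R where "R n = inverse (3 ^ n) / (2::real)" for n :: nat
  have incr: "h2_norm (\<lambda>z. X m z - X n z) \<le> R n - R m" if "n \<le> m" for m n
    using that
  proof (induction m rule: dec_induct)
    case base
    show ?case by (simp add: h2_norm_def taylor_coeff_def)
  next
    case (step m)
    have "(\<lambda>z. X (Suc m) z - X n z) = (\<lambda>z. (X m z - X n z) + S (X m) m * v m z)"
      by (simp add: X_Suc fun_eq_iff)
    hence "h2_norm (\<lambda>z. X (Suc m) z - X n z) \<le> h2_norm (\<lambda>z. X m z - X n z) + h2_norm (\<lambda>z. S (X m) m * v m z)"
      by (simp only:) (intro h2_norm_triangle hardy2_diff hardy2_cmult H XM vM)
    also have "h2_norm (\<lambda>z. S (X m) m * v m z) = R m - R (Suc m)"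
      by (simp add: h2_norm_cmult H vM S XM vnorm R_def)
    finally show ?case using step.IH by simp
  qed
  have R_nonneg: "R n \<ge> 0" for n by (simp add: R_def)
  have R0: "R \<longlonglongrightarrow> 0"
    unfolding R_def[abs_def] using LIMSEQ_inverse_realpow_zero[of 3] tendsto_divide_zero by force
  obtain f where f: "f \<in> hardy2" "\<And>n. h2_norm (\<lambda>z. f z - X n z) \<le> R n"
  proof (rule hardy2_complete[of X R])
    show "h2_norm (\<lambda>z. X m z - X n z) \<le> R n" if "n \<le> m" for m n
      using incr[OF that] R_nonneg[of m] by simp
  qed (use H XM R0 in auto)
  have "(\<lambda>n. h2_norm (\<lambda>z. X n z - f z)) \<longlonglongrightarrow> 0"
    by (rule tendsto_sandwich[OF _ _ tendsto_const R0])
      (use f(2) in \<open>auto simp: h2_norm_minus_commute[OF H[OF XM] f(1)] hardy2_diff f(1) H XM intro!: always_eventually\<close>)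
  hence fM: "f \<in> M" by (rule closed_subspaceD(5)[OF M, where F = X, OF XM f(1)])
  have big: "cmod (h2_inner f (u n)) \<ge> n" for n
  proof -
    let ?b = "h2_norm (u n) / 3 ^ Suc n"
    have "?b \<le> cmod (h2_inner (X (Suc n)) (u n))"
      unfolding X_Suc by (rule S[OF XM])
    also have "h2_inner (X (Suc n)) (u n) = h2_inner f (u n) - h2_inner (\<lambda>z. f z - X (Suc n) z) (u n)"
      by (simp add: h2_inner_diff_left f H XM uM)
    also have "cmod \<dots> \<le> cmod (h2_inner f (u n)) + cmod (h2_inner (\<lambda>z. f z - X (Suc n) z) (u n))"
      by (rule norm_triangle_ineq4)
    also have "cmod (h2_inner (\<lambda>z. f z - X (Suc n) z) (u n)) \<le>
        h2_norm (\<lambda>z. f z - X (Suc n) z) * h2_norm (u n)"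
      by (intro h2_Cauchy_Schwarz hardy2_diff f H XM uM)
    also have "\<dots> \<le> R (Suc n) * h2_norm (u n)"
      by (intro mult_right_mono f) (use upos[of n] in simp)
    also have "\<dots> = ?b / 2" by (simp add: R_def field_simps)
    finally have "?b / 2 \<le> cmod (h2_inner f (u n))" by simp
    moreover have "real n \<le> ?b / 2" using u(2)[of n] by (simp add: field_simps)
    ultimately show ?thesis by simp
  qed
  obtain C where C: "\<And>w. w \<in> U \<Longrightarrow> cmod (h2_inner f w) \<le> C"
    using bdd[OF fM] by (auto simp: bdd_above_def)
  obtain n :: nat where "C < n" using reals_Archimedean2 by blast
  with big[of n] C[OF u(1), of n] show False by simp
qed

section \<open>Limits in Stolz domains\<close>

lemma stolz_subset: "stolz \<alpha> \<zeta> \<subseteq> unit_disc"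
  by (auto simp: stolz_def)

lemma stolz_mono: "\<alpha> \<le> \<beta> \<Longrightarrow> stolz \<alpha> \<zeta> \<subseteq> stolz \<beta> \<zeta>"
  by (auto simp: stolz_def)

lemma eventually_at_within_stolz: "\<forall>\<^sub>F w in at \<zeta> within stolz \<alpha> \<zeta>. w \<in> stolz \<alpha> \<zeta>"
  by (auto simp: eventually_at_filter)

lemma at_within_stolz_nontrivial:
  assumes z: "\<zeta> \<in> sphere 0 1" and a: "\<alpha> > 1"
  shows "at \<zeta> within stolz \<alpha> \<zeta> \<noteq> bot"
proof -
  have "\<zeta> islimpt stolz \<alpha> \<zeta>"
    unfolding islimpt_approachable
  proof (intro allI impI)
    fix e :: real assume e: "e > 0"
    define s where "s = min (1/2) (e/2)"
    have s: "0 < s" "s < 1" "s < e" using e by (auto simp: s_def)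
    have 1: "cmod (of_real (1 - s) * \<zeta>) = 1 - s" using z s by (simp add: norm_mult del: of_real_diff)
    have "of_real (1 - s) * \<zeta> - \<zeta> = - (of_real s * \<zeta>)" by (simp add: algebra_simps)
    hence 2: "cmod (of_real (1 - s) * \<zeta> - \<zeta>) = s"
      using z s by (simp add: norm_mult del: of_real_diff)
    show "\<exists>x'\<in>stolz \<alpha> \<zeta>. x' \<noteq> \<zeta> \<and> dist x' \<zeta> < e"
    proof (intro bexI[of _ "of_real (1 - s) * \<zeta>"] conjI)
      show "of_real (1 - s) * \<zeta> \<in> stolz \<alpha> \<zeta>"
        unfolding stolz_def using 1 2 s a by (simp del: of_real_diff)
      show "of_real (1 - s) * \<zeta> \<noteq> \<zeta>" using 2 s by auto
      show "dist (of_real (1 - s) * \<zeta>) \<zeta> < e" using 2 s by (simp add: dist_norm del: of_real_diff)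
    qed
  qed
  thus ?thesis by (simp add: trivial_limit_within)
qed

text \<open>
  Stolz domains increase with their aperture and each of them accumulates at the vertex, so the
  limits obtained for different apertures agree.
\<close>

lemma ex_nt_limitI:
  assumes z: "\<zeta> \<in> sphere 0 1"
    and lim: "\<And>\<alpha>. \<alpha> > 1 \<Longrightarrow> \<exists>L. (f \<longlongrightarrow> L) (at \<zeta> within stolz \<alpha> \<zeta>)"
  shows "\<exists>L. has_nt_limit f \<zeta> L"
proof -
  obtain L where L: "(f \<longlongrightarrow> L) (at \<zeta> within stolz 2 \<zeta>)" using lim[of 2] by auto
  have "(f \<longlongrightarrow> L) (at \<zeta> within stolz \<alpha> \<zeta>)" if a: "\<alpha> > 1" for \<alpha>
  proof -
    obtain L' where L': "(f \<longlongrightarrow> L') (at \<zeta> within stolz (max 2 \<alpha>) \<zeta>)" using lim[of "max 2 \<alpha>"] by fastforce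
    have "(f \<longlongrightarrow> L') (at \<zeta> within stolz 2 \<zeta>)"
      by (rule tendsto_within_subset[OF L' stolz_mono]) simp
    hence "L = L'" using tendsto_unique[OF at_within_stolz_nontrivial[OF z] L] by simp
    with tendsto_within_subset[OF L' stolz_mono, of \<alpha>] show ?thesis by simp
  qed
  thus ?thesis unfolding has_nt_limit_def by blast
qed

text \<open>
  Outside a disc of radius \<open>d\<close> around the vertex, a point of the Stolz domain satisfies
  \<open>1 - cmod w > d / \<alpha>\<close> and therefore stays in a compact subset of the unit disc.
\<close>

lemma bounded_on_stolz:
  assumes f: "f holomorphic_on unit_disc" and z: "\<zeta> \<in> sphere 0 1" and a: "\<alpha> > 1"
    and lim: "(f \<longlongrightarrow> L) (at \<zeta> within stolz \<alpha> \<zeta>)"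
  obtains C where "\<And>w. w \<in> stolz \<alpha> \<zeta> \<Longrightarrow> cmod (f w) \<le> C"
proof -
  have "\<forall>\<^sub>F w in at \<zeta> within stolz \<alpha> \<zeta>. dist (f w) L < 1"
    using lim by (rule tendstoD) simp
  then obtain d where d: "d > 0" "\<And>w. w \<in> stolz \<alpha> \<zeta> \<Longrightarrow> w \<noteq> \<zeta> \<Longrightarrow> dist w \<zeta> < d \<Longrightarrow> dist (f w) L < 1"
    by (auto simp: eventually_at)
  define K where "K = cball (0::complex) (1 - d / \<alpha>)"
  have "d / \<alpha> > 0" using d(1) a by simp
  hence "K \<subseteq> unit_disc" by (auto simp: K_def)
  hence "continuous_on K f"
    by (rule continuous_on_subset[OF holomorphic_on_imp_continuous_on[OF f]])
  hence "bounded (f ` K)"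
    by (intro compact_imp_bounded compact_continuous_image) (auto simp: K_def)
  then obtain B where B: "\<And>w. w \<in> K \<Longrightarrow> cmod (f w) \<le> B" by (auto simp: bounded_iff)
  show thesis
  proof (rule that[of "max B (cmod L + 1)"])
    fix w assume w: "w \<in> stolz \<alpha> \<zeta>"
    show "cmod (f w) \<le> max B (cmod L + 1)"
    proof (cases "dist w \<zeta> < d")
      case True
      have "w \<noteq> \<zeta>" using w z by (auto simp: stolz_def)
      with d(2)[OF w _ True] have "cmod (f w - L) < 1" by (simp add: dist_norm)
      with norm_triangle_sub[of "f w" L] show ?thesis by simp
    next
      case False
      have "d \<le> cmod (w - \<zeta>)" using False by (simp add: dist_norm)
      also have "\<dots> < \<alpha> * (1 - cmod w)" using w by (auto simp: stolz_def field_simps)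
      finally have "w \<in> K" using a by (auto simp: K_def field_simps)
      with B[of w] show ?thesis by simp
    qed
  qed
qed

lemma tendsto_if_Cauchy_filter:
  fixes f :: "'a \<Rightarrow> 'b :: complete_space"
  assumes F: "F \<noteq> bot"
    and C: "\<And>e. e > 0 \<Longrightarrow> \<forall>\<^sub>F p in F \<times>\<^sub>F F. dist (f (fst p)) (f (snd p)) < e"
  shows "\<exists>L. (f \<longlongrightarrow> L) F"
proof -
  have "cauchy_filter (filtermap f F)"
    unfolding cauchy_filter_metric_filtermap
  proof (intro allI impI)
    fix e :: real assume "e > 0"
    from C[OF this] show "\<exists>P. eventually P F \<and> (\<forall>x y. P x \<and> P y \<longrightarrow> dist (f x) (f y) < e)"
      by (auto simp: eventually_prod_same)
  qed
  moreover have "filtermap f F \<noteq> bot" using F by (simp add: filtermap_bot_iff)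
  ultimately have "\<exists>L. filtermap f F \<le> nhds L"
    using complete_UNIV[unfolded complete_uniform] by auto
  thus ?thesis by (simp add: filterlim_def)
qed

lemma tendsto_prod_filter:
  assumes "(f \<longlongrightarrow> L) F"
  shows "((\<lambda>p. f (fst p)) \<longlongrightarrow> L) (F \<times>\<^sub>F F)" "((\<lambda>p. f (snd p)) \<longlongrightarrow> L) (F \<times>\<^sub>F F)"
  by (rule filterlim_compose[OF assms filterlim_fst] filterlim_compose[OF assms filterlim_snd])+

lemma tendsto_if_uniform_approx:
  fixes f :: "'a \<Rightarrow> 'b :: complete_space"
  assumes F: "F \<noteq> bot"
    and approx: "\<And>e. e > 0 \<Longrightarrow> \<exists>h L. (h \<longlongrightarrow> L) F \<and> (\<forall>\<^sub>F x in F. dist (f x) (h x) < e)"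
  shows "\<exists>L. (f \<longlongrightarrow> L) F"
proof (rule tendsto_if_Cauchy_filter[OF F])
  fix e :: real assume e: "e > 0"
  with approx[of "e / 4"] obtain h L where h: "(h \<longlongrightarrow> L) F" "\<forall>\<^sub>F x in F. dist (f x) (h x) < e / 4"
    by auto
  have "\<forall>\<^sub>F x in F. dist (h x) L < e / 4" using h(1) e by (intro tendstoD) auto
  hence "\<forall>\<^sub>F x in F. dist (f x) L < e / 2"
    using h(2)
  proof eventually_elim
    case (elim x)
    thus ?case using dist_triangle[of "f x" L "h x"] by simp
  qed
  thus "\<forall>\<^sub>F p in F \<times>\<^sub>F F. dist (f (fst p)) (f (snd p)) < e"
    unfolding eventually_prod_same using dist_triangle_half_l by fastforce
qed

text \<open>
  The limit of \<open>cnj (G x) * G y\<close> in both variables determines that of each of the three terms in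
  \<open>(cmod (G x - G y))\<^sup>2 = (cmod (G x))\<^sup>2 + (cmod (G y))\<^sup>2 - 2 * Re (cnj (G x) * G y)\<close>; these limits cancel.
\<close>

lemma tendsto_if_polarized_limit:
  fixes G :: "'a \<Rightarrow> complex"
  assumes F: "F \<noteq> bot" and c: "((\<lambda>p. cnj (G (fst p)) * G (snd p)) \<longlongrightarrow> of_real c) (F \<times>\<^sub>F F)"
  shows "\<exists>L. (G \<longlongrightarrow> L) F"
proof (rule tendsto_if_Cauchy_filter[OF F])
  fix e :: real assume e: "e > 0"
  have diag: "filterlim (\<lambda>x. (x, x)) (F \<times>\<^sub>F F) F"
    by (intro filterlim_Pair filterlim_ident)
  have "((\<lambda>x. Re (cnj (G x) * G x)) \<longlongrightarrow> Re (of_real c)) F"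
    using tendsto_Re[OF filterlim_compose[OF c diag]] by simp
  hence n: "((\<lambda>x. (cmod (G x))\<^sup>2) \<longlongrightarrow> c) F"
    by (simp only: cmod_power2) (simp add: power2_eq_square)
  have "((\<lambda>p. (cmod (G (fst p)))\<^sup>2 + (cmod (G (snd p)))\<^sup>2 - 2 * Re (cnj (G (fst p)) * G (snd p)))
      \<longlongrightarrow> c + c - 2 * Re (of_real c)) (F \<times>\<^sub>F F)"
    by (intro tendsto_intros tendsto_prod_filter n c)
  hence "((\<lambda>p. (dist (G (fst p)) (G (snd p)))\<^sup>2) \<longlongrightarrow> 0) (F \<times>\<^sub>F F)"
    by (simp only: dist_norm cmod_power2) (simp add: power2_eq_square algebra_simps)
  hence "\<forall>\<^sub>F p in F \<times>\<^sub>F F. (dist (G (fst p)) (G (snd p)))\<^sup>2 < e\<^sup>2"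
    using e by (auto simp: order_tendsto_iff)
  thus "\<forall>\<^sub>F p in F \<times>\<^sub>F F. dist (G (fst p)) (G (snd p)) < e"
    by eventually_elim (use e in \<open>auto intro: power2_less_imp_less\<close>)
qed

section \<open>Images of model spaces under isometric multipliers\<close>

locale isometric_multiplier =
  fixes g I :: "complex \<Rightarrow> complex"
  assumes I: "inner_function I"
    and mult_hardy2: "h \<in> model_space I \<Longrightarrow> (\<lambda>z. g z * h z) \<in> hardy2"
    and mult_isometry: "h \<in> model_space I \<Longrightarrow> h2_norm (\<lambda>z. g z * h z) = h2_norm h"
begin

definition gK :: "(complex \<Rightarrow> complex) set" where
  "gK = (\<lambda>h z. g z * h z) ` model_space I"

abbreviation gK_kernel :: "complex \<Rightarrow> complex \<Rightarrow> complex" where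
  "gK_kernel w \<equiv> reproducing_kernel gK w"

lemma gK_iff: "f \<in> gK \<longleftrightarrow> (\<exists>h\<in>model_space I. f = (\<lambda>z. g z * h z))"
  by (auto simp: gK_def)

lemma gK_hardy2: "f \<in> gK \<Longrightarrow> f \<in> hardy2"
  by (auto simp: gK_def mult_hardy2)

lemma kernel_formula_and_reproducing:
  assumes w: "w \<in> unit_disc"
  shows "gK_kernel w = (\<lambda>z. g z * (cnj (g w) * model_kernel I w z))"
    and "gK_kernel w \<in> gK"
    and "\<forall>f\<in>gK. h2_inner f (gK_kernel w) = f w"
proof -
  let ?h = "\<lambda>z. cnj (g w) * model_kernel I w z"
  let ?k = "\<lambda>z. g z * ?h z"
  have h: "?h \<in> model_space I" by (intro model_space_cmult model_kernel_in I w)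
  have k: "?k \<in> gK" unfolding gK_def using h by (rule imageI)
  have rep: "\<forall>f\<in>gK. h2_inner f ?k = f w"
  proof
    fix F assume "F \<in> gK"
    then obtain f where f: "f \<in> model_space I" and F: "F = (\<lambda>z. g z * f z)"
      by (auto simp: gK_iff)
    have "h2_inner (\<lambda>z. g z * f z) ?k = h2_inner f ?h"
      by (rule h2_inner_isometric_mult[of "model_space I"])
        (use f h in \<open>auto intro: model_space_add model_space_cmult I model_spaceD mult_hardy2 mult_isometry\<close>)
    also have "\<dots> = g w * f w"
      by (simp add: h2_inner_cmult_right model_spaceD(1)[OF f] model_spaceD(1)[OF model_kernel_in[OF I w]]
          h2_inner_model_kernel[OF I w f])
    finally show "h2_inner F ?k = F w" unfolding F .
  qed
  note H = gK_hardy2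
  show eq: "gK_kernel w = ?k"
    unfolding reproducing_kernel_def
  proof (rule the_equality)
    fix k' assume k': "k' \<in> gK \<and> (\<forall>f\<in>gK. h2_inner f k' = f w)"
    let ?d = "\<lambda>z. k' z - ?k z"
    have d: "?d \<in> gK"
    proof -
      from k' obtain h' where h': "h' \<in> model_space I" "k' = (\<lambda>z. g z * h' z)" by (auto simp: gK_iff)
      show ?thesis
        unfolding gK_def by (rule image_eqI[OF _ model_space_diff[OF I h'(1) h]]) (simp add: h' fun_eq_iff algebra_simps)
    qed
    have "h2_inner ?d ?d = h2_inner ?d k' - h2_inner ?d ?k"
      using k' by (intro h2_inner_diff_right H d k) auto
    also have "\<dots> = 0" using k' rep d by simp
    finally have "h2_norm ?d = 0" using h2_inner_self[OF H[OF d]] by simp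
    from h2_norm_eq_0[OF H[OF d] this] show "k' = ?k" by (simp add: fun_eq_iff)
  qed (use k rep in blast)
  show "gK_kernel w \<in> gK" "\<forall>f\<in>gK. h2_inner f (gK_kernel w) = f w"
    unfolding eq by (fact k rep)+
qed

lemma kernel_hardy2: "w \<in> unit_disc \<Longrightarrow> gK_kernel w \<in> hardy2"
  by (rule gK_hardy2[OF kernel_formula_and_reproducing(2)])

lemma kernel_apply:
  assumes "w \<in> unit_disc" "z \<in> unit_disc"
  shows "gK_kernel w z = cnj (g w) * g z * (1 - cnj (I w) * I z) / (1 - cnj w * z)"
  using assms by (simp add: kernel_formula_and_reproducing(1)[OF assms(1)] model_kernel_def szego_def
      diff_divide_distrib algebra_simps)

lemma h2_norm_kernel_sq:
  assumes w: "w \<in> unit_disc"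
  shows "(h2_norm (gK_kernel w))\<^sup>2 = (cmod (g w))\<^sup>2 * ((1 - (cmod (I w))\<^sup>2) / (1 - (cmod w)\<^sup>2))"
proof -
  have "complex_of_real ((h2_norm (gK_kernel w))\<^sup>2) = gK_kernel w w"
    using kernel_formula_and_reproducing(2,3)[OF w] h2_inner_self[OF kernel_hardy2[OF w]] by metis
  also have "\<dots> = (g w * cnj (g w)) * (1 - I w * cnj (I w)) / (1 - w * cnj w)"
    by (simp only: kernel_apply[OF w w]) (simp add: mult_ac)
  also have "\<dots> = of_real ((cmod (g w))\<^sup>2 * ((1 - (cmod (I w))\<^sup>2) / (1 - (cmod w)\<^sup>2)))"
    by (simp add: complex_norm_square[symmetric] del: of_real_power)
  finally show ?thesis by (simp only: of_real_eq_iff)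
qed

lemma cmod_le_kernel:
  assumes "f \<in> gK" "w \<in> unit_disc"
  shows "cmod (f w) \<le> h2_norm f * h2_norm (gK_kernel w)"
  using kernel_formula_and_reproducing(3)[OF assms(2)] h2_Cauchy_Schwarz[OF _ kernel_hardy2[OF assms(2)], of f]
    assms gK_hardy2[of f] by fastforce

text \<open>
  The kernels represent the point evaluations, which are pointwise bounded on a Stolz domain.
\<close>

lemma kernels_bounded:
  assumes closed: "closed_subspace_h2 gK" and z: "\<zeta> \<in> sphere 0 1" and a: "\<alpha> > 1"
    and lim: "\<forall>f\<in>gK. \<exists>L. has_nt_limit f \<zeta> L"
  shows "bdd_above ((\<lambda>w. (h2_norm (gK_kernel w))\<^sup>2) ` stolz \<alpha> \<zeta>)"
proof -
  have "bdd_above (h2_norm ` gK_kernel ` stolz \<alpha> \<zeta>)"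
  proof (rule uniform_boundedness_h2[OF closed])
    show "gK_kernel ` stolz \<alpha> \<zeta> \<subseteq> gK"
      using kernel_formula_and_reproducing(2) stolz_subset by blast
    fix f assume f: "f \<in> gK"
    then obtain L where "(f \<longlongrightarrow> L) (at \<zeta> within stolz \<alpha> \<zeta>)"
      using lim a by (meson has_nt_limit_def)
    then obtain C where "\<And>w. w \<in> stolz \<alpha> \<zeta> \<Longrightarrow> cmod (f w) \<le> C"
      using bounded_on_stolz[OF hardy2D(1)[OF closed_subspaceD(1)[OF closed f]] z a] by blast
    thus "bdd_above ((\<lambda>u. cmod (h2_inner f u)) ` gK_kernel ` stolz \<alpha> \<zeta>)"
      using kernel_formula_and_reproducing(3) f stolz_subset by (intro bdd_aboveI[of _ C]) fastforce
  qed
  then obtain C where C: "\<And>w. w \<in> stolz \<alpha> \<zeta> \<Longrightarrow> h2_norm (gK_kernel w) \<le> C"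
    by (auto simp: bdd_above_def)
  show ?thesis
  proof (rule bdd_aboveI2[of _ _ "C\<^sup>2"])
    fix w assume w: "w \<in> stolz \<alpha> \<zeta>"
    thus "(h2_norm (gK_kernel w))\<^sup>2 \<le> C\<^sup>2"
      using C[OF w] kernel_hardy2 stolz_subset by (intro power_mono h2_norm_nonneg) blast+
  qed
qed

text \<open>
  The function \<open>I\<close> does not belong to its own model space, so the limit of \<open>g * I\<close> has to be extracted
  from the kernels: by Cauchy-Schwarz, \<open>cnj (g x) * g y * (1 - cnj (I x) * I y)\<close> is bounded by
  a multiple of \<open>1 - cnj x * y\<close>. Treating \<open>g * I\<close> as one function covers the case that \<open>g\<close> tends to zero, in which
  \<open>I\<close> itself may have no limit.
\<close>

lemma tendsto_gI:
  assumes z: "\<zeta> \<in> sphere 0 1" and a: "\<alpha> > 1"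
    and g: "(g \<longlongrightarrow> L) (at \<zeta> within stolz \<alpha> \<zeta>)"
    and C: "\<And>w. w \<in> stolz \<alpha> \<zeta> \<Longrightarrow> h2_norm (gK_kernel w) \<le> C"
  shows "\<exists>L'. ((\<lambda>w. g w * I w) \<longlongrightarrow> L') (at \<zeta> within stolz \<alpha> \<zeta>)"
proof -
  define F where "F = at \<zeta> within stolz \<alpha> \<zeta>"
  define G where "G w = g w * I w" for w
  have F: "F \<noteq> bot" unfolding F_def by (rule at_within_stolz_nontrivial[OF z a])
  have id: "((\<lambda>w. w) \<longlongrightarrow> \<zeta>) F" unfolding F_def by (rule tendsto_ident_at)
  have key: "cmod (cnj (g x) * g y - cnj (G x) * G y) \<le> C\<^sup>2 * cmod (1 - cnj x * y)"
    if x: "x \<in> stolz \<alpha> \<zeta>" and y: "y \<in> stolz \<alpha> \<zeta>" for x y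
  proof -
    have d: "x \<in> unit_disc" "y \<in> unit_disc" using x y stolz_subset by blast+
    have "cmod (cnj x * y) < 1"
      using d mult_strict_mono[of "cmod x" 1 "cmod y" 1] by (simp add: norm_mult)
    hence nz: "1 - cnj x * y \<noteq> 0" by auto
    have "cmod (gK_kernel x y) \<le> h2_norm (gK_kernel x) * h2_norm (gK_kernel y)"
      by (rule cmod_le_kernel[OF kernel_formula_and_reproducing(2)]) (fact d)+
    also have "\<dots> \<le> C * C"
      by (intro mult_mono C x y h2_norm_nonneg kernel_hardy2 d
          order.trans[OF h2_norm_nonneg[OF kernel_hardy2[OF d(1)]] C[OF x]])
    finally have "cmod (gK_kernel x y) \<le> C\<^sup>2" by (simp add: power2_eq_square)
    moreover have "gK_kernel x y * (1 - cnj x * y) = cnj (g x) * g y * (1 - cnj (I x) * I y)"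
      unfolding kernel_apply[OF d] using nz by (metis nonzero_eq_divide_eq)
    hence "cnj (g x) * g y - cnj (G x) * G y = gK_kernel x y * (1 - cnj x * y)"
      by (simp add: G_def algebra_simps)
    ultimately show ?thesis by (simp add: norm_mult mult_right_mono)
  qed
  have "((\<lambda>p. C\<^sup>2 * cmod (1 - cnj (fst p) * snd p)) \<longlongrightarrow> C\<^sup>2 * cmod (1 - cnj \<zeta> * \<zeta>)) (F \<times>\<^sub>F F)"
    by (intro tendsto_intros tendsto_prod_filter id)
  moreover have "cnj \<zeta> * \<zeta> = 1"
    using z complex_norm_square[of \<zeta>] by (simp add: mult.commute)
  ultimately have b0: "((\<lambda>p. C\<^sup>2 * cmod (1 - cnj (fst p) * snd p)) \<longlongrightarrow> 0) (F \<times>\<^sub>F F)" by simp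
  have "\<forall>\<^sub>F p in F \<times>\<^sub>F F. fst p \<in> stolz \<alpha> \<zeta> \<and> snd p \<in> stolz \<alpha> \<zeta>"
    unfolding eventually_prod_same F_def using eventually_at_within_stolz by auto
  hence "\<forall>\<^sub>F p in F \<times>\<^sub>F F. norm (cnj (g (fst p)) * g (snd p) - cnj (G (fst p)) * G (snd p))
      \<le> C\<^sup>2 * cmod (1 - cnj (fst p) * snd p)"
    by eventually_elim (use key in auto)
  hence "((\<lambda>p. cnj (g (fst p)) * g (snd p) - cnj (G (fst p)) * G (snd p)) \<longlongrightarrow> 0) (F \<times>\<^sub>F F)"
    by (rule Lim_null_comparison[OF _ b0])
  moreover have "((\<lambda>p. cnj (g (fst p)) * g (snd p)) \<longlongrightarrow> cnj L * L) (F \<times>\<^sub>F F)"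
    using g unfolding F_def[symmetric] by (intro tendsto_intros tendsto_prod_filter)
  ultimately have "((\<lambda>p. cnj (G (fst p)) * G (snd p)) \<longlongrightarrow> cnj L * L) (F \<times>\<^sub>F F)"
    using tendsto_diff by fastforce
  hence "((\<lambda>p. cnj (G (fst p)) * G (snd p)) \<longlongrightarrow> of_real ((cmod L)\<^sup>2)) (F \<times>\<^sub>F F)"
    by (simp only: complex_norm_square mult.commute[of L])
  from tendsto_if_polarized_limit[OF F this] show ?thesis unfolding F_def G_def .
qed

text \<open>
  The limits of \<open>g\<close> and \<open>g * I\<close> settle the case of a dense set of functions; bounded kernels make
  norm approximation uniform on the Stolz domain.
\<close>

lemma nt_limit_if_kernels_bounded:
  assumes z: "\<zeta> \<in> sphere 0 1" and a: "\<alpha> > 1"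
    and g: "(g \<longlongrightarrow> L) (at \<zeta> within stolz \<alpha> \<zeta>)"
    and bdd: "bdd_above ((\<lambda>w. (h2_norm (gK_kernel w))\<^sup>2) ` stolz \<alpha> \<zeta>)"
    and f: "f \<in> gK"
  shows "\<exists>L. (f \<longlongrightarrow> L) (at \<zeta> within stolz \<alpha> \<zeta>)"
proof -
  obtain B where B: "\<And>w. w \<in> stolz \<alpha> \<zeta> \<Longrightarrow> (h2_norm (gK_kernel w))\<^sup>2 \<le> B"
    using bdd by (auto simp: bdd_above_def)
  \<comment> \<open>The summand \<open>1\<close> makes \<open>C\<close> positive, so that the norm error \<open>e / C\<close> can be prescribed.\<close>
  define C where "C = sqrt \<bar>B\<bar> + 1"
  have C: "h2_norm (gK_kernel w) \<le> C" if "w \<in> stolz \<alpha> \<zeta>" for w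
    using real_le_rsqrt[OF order.trans[OF B[OF that] abs_ge_self]] by (simp add: C_def)
  have C0: "C > 0" unfolding C_def by (smt (verit) real_sqrt_ge_zero abs_ge_zero)
  obtain L' where gI: "((\<lambda>w. g w * I w) \<longlongrightarrow> L') (at \<zeta> within stolz \<alpha> \<zeta>)"
    using tendsto_gI[OF z a g C] by blast
  from f obtain h where h: "h \<in> model_space I" and fh: "f = (\<lambda>z. g z * h z)"
    by (auto simp: gK_iff)
  show ?thesis
  proof (rule tendsto_if_uniform_approx[OF at_within_stolz_nontrivial[OF z a]])
    fix e :: real assume e: "e > 0"
    then obtain k P Q where k: "k \<in> model_space I" "h2_norm (\<lambda>z. h z - k z) < e / C"
      and PQ: "continuous_on UNIV P" "continuous_on UNIV Q" "\<And>z. z \<in> unit_disc \<Longrightarrow> k z = P z - I z * Q z"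
      using model_space_dense[OF I h, of "e / C"] C0 by auto
    have lim: "((\<lambda>w. g w * P w - g w * I w * Q w) \<longlongrightarrow> L * P \<zeta> - L' * Q \<zeta>) (at \<zeta> within stolz \<alpha> \<zeta>)"
      using PQ(1,2) by (intro tendsto_intros g gI)
        (auto simp: continuous_on_def intro: tendsto_within_subset)
    have "dist (f w) (g w * P w - g w * I w * Q w) < e" if w: "w \<in> stolz \<alpha> \<zeta>" for w
    proof -
      have d: "w \<in> unit_disc" using w stolz_subset by blast
      let ?d = "\<lambda>z. h z - k z"
      have dm: "?d \<in> model_space I" by (rule model_space_diff[OF I h k(1)])
      have "dist (f w) (g w * P w - g w * I w * Q w) = cmod (g w * ?d w)"
        by (simp add: dist_norm fh PQ(3)[OF d] algebra_simps)
      also have "\<dots> \<le> h2_norm (\<lambda>z. g z * ?d z) * h2_norm (gK_kernel w)"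
        by (rule cmod_le_kernel[OF _ d, of "\<lambda>z. g z * ?d z"]) (use dm in \<open>auto simp: gK_def\<close>)
      also have "\<dots> \<le> h2_norm ?d * C"
        unfolding mult_isometry[OF dm] using C[OF w] model_spaceD(1)[OF dm] by (intro mult_left_mono) auto
      also have "\<dots> < e" using k(2) C0 by (simp add: field_simps)
      finally show ?thesis .
    qed
    hence "\<forall>\<^sub>F w in at \<zeta> within stolz \<alpha> \<zeta>. dist (f w) (g w * P w - g w * I w * Q w) < e"
      by (rule eventually_mono[OF eventually_at_within_stolz])
    with lim show "\<exists>h L. (h \<longlongrightarrow> L) (at \<zeta> within stolz \<alpha> \<zeta>) \<and>
        (\<forall>\<^sub>F w in at \<zeta> within stolz \<alpha> \<zeta>. dist (f w) (h w) < e)" by blast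
  qed
qed

end

section \<open>The criterion for non-tangential limits\<close>

theorem theorem4p5:
  fixes M :: "(complex \<Rightarrow> complex) set"
    and g I :: "complex \<Rightarrow> complex"
    and \<zeta> :: complex
  assumes "nearly_invariant M"
    and "M \<noteq> {\<lambda>_. 0}"
    and "extremal_function M g"
    and "inner_function I"
    and "I 0 = 0"
    and "M = (\<lambda>h z. g z * h z) ` model_space I"
    and "\<forall>h\<in>model_space I. h2_norm (\<lambda>z. g z * h z) = h2_norm h"
    and "\<zeta> \<in> sphere 0 1"
  shows "(\<forall>w\<in>unit_disc. (h2_norm (reproducing_kernel M w))\<^sup>2 =
            (cmod (g w))\<^sup>2 * ((1 - (cmod (I w))\<^sup>2) / (1 - (cmod w)\<^sup>2)))
       \<and> ((\<forall>f\<in>M. \<exists>L. has_nt_limit f \<zeta> L) \<longleftrightarrow>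
           (\<exists>L. has_nt_limit g \<zeta> L) \<and>
           (\<forall>\<alpha>>1. bdd_above ((\<lambda>w. (h2_norm (reproducing_kernel M w))\<^sup>2) ` stolz \<alpha> \<zeta>)))"
proof -
  have closed: "closed_subspace_h2 M" using assms(1) by (simp add: nearly_invariant_def)
  have gM: "g \<in> M" using assms(3) by (simp add: extremal_function_def is_arg_max_def)
  interpret isometric_multiplier g I
    by standard (use assms closed_subspaceD(1)[OF closed] in auto)
  have M: "M = gK" unfolding gK_def by fact
  have iff: "(\<forall>f\<in>M. \<exists>L. has_nt_limit f \<zeta> L) \<longleftrightarrow> (\<exists>L. has_nt_limit g \<zeta> L) \<and>
      (\<forall>\<alpha>>1. bdd_above ((\<lambda>w. (h2_norm (reproducing_kernel M w))\<^sup>2) ` stolz \<alpha> \<zeta>))" (is "?lim \<longleftrightarrow> ?g \<and> ?bdd")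
  proof
    assume lim: ?lim
    hence ?g using gM by blast
    moreover have ?bdd
      unfolding M by (intro allI impI kernels_bounded[OF closed[unfolded M] assms(8) _ lim[unfolded M]])
    ultimately show "?g \<and> ?bdd" ..
  next
    assume *: "?g \<and> ?bdd"
    show ?lim
    proof
      fix f assume "f \<in> M"
      with * show "\<exists>L. has_nt_limit f \<zeta> L"
        using nt_limit_if_kernels_bounded[OF assms(8)] unfolding M has_nt_limit_def[of g]
        by (intro ex_nt_limitI[OF assms(8)]) blast
    qed
  qed
  show ?thesis
    by (rule conjI[OF ballI iff]) (unfold M, rule h2_norm_kernel_sq)
qed

end
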